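(* Every local operator algebra of functions on a set $X$ is RFD.
   Context: An (abstract, unital) operator algebra is a unital algebra with a norm on each matrix level satisfying the Blecher–Ruan–Sinclair (BRS) axioms: $\|LGM\|\le\|L\|\|G\|\|M\|$ for scalar matrices $L,M$; $\|G\oplus H\|=\max\{\|G\|,\|H\|\}$; $\|GH\|\le\|G\|\|H\|$; $\|1\|=1$. Completeness is not assumed. An operator algebra of functions on $X$ is a subalgebra $\mathcal A$ of the algebra of all complex-valued functions on $X$ which separates the points of $X$ and contains the constants, is equipped with norms on all $M_n(\mathcal A)$ satisfying the BRS axioms, and has every evaluation functional $f\mapsto f(x)$, $x\in X$, bounded. For finite $F\subseteq X$ let $I_F=\{f\in\mathcal A:f|_F=0\}$ and give $M_n(\mathcal A/I_F)=M_n(\mathcal A)/M_n(I_F)$ the quotient norm. $\mathcal A$ is local if $\|(f_{ij})\|=\sup_F\|(f_{ij}+I_F)\|$ for all $n$ and $(f_{ij})\in M_n(\mathcal A)$, the supremum being over finite $F\subseteq X$. An operator algebra $\mathcal B$ is RFD (residually finite dimensional) if for every $n$ and every $(b_{ij})\in M_n(\mathcal B)$, $\|(b_{ij})\|=\sup\|(\pi(b_{ij}))\|$, the supremum being over all completely contractive homomorphisms $\pi:\mathcal B\to M_k$ and all positive integers $k$. *)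

theory Defs
  imports
    "HOL-Library.Function_Algebras"
    "HOL-Analysis.L2_Norm"
    "Jordan_Normal_Form.Matrix"
begin

section \<open>Scalar matrices\<close>

definition cvec_norm :: "complex vec \<Rightarrow> real" where
  "cvec_norm v = L2_set (\<lambda>i. cmod (v $ i)) {..<dim_vec v}"

definition op_norm :: "complex mat \<Rightarrow> real" where
  "op_norm L = (SUP v \<in> {v \<in> carrier_vec (dim_col L). cvec_norm v \<le> 1}. cvec_norm (L *\<^sub>v v))"


section \<open>Abstract unital operator algebras\<close>

definition matrices_over :: "nat \<Rightarrow> 'a set \<Rightarrow> 'a mat set" where
  "matrices_over n B = {G \<in> carrier_mat n n. elements_mat G \<subseteq> B}"

text \<open>The product \<open>L G M\<close> of an algebra-valued matrix \<open>G\<close> with scalar matrices \<open>L\<close> and \<open>M\<close>.\<close>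

definition scalar_sandwich ::
  "(complex \<Rightarrow> 'a \<Rightarrow> 'a::ring_1) \<Rightarrow> complex mat \<Rightarrow> 'a mat \<Rightarrow> complex mat \<Rightarrow> 'a mat" where
  "scalar_sandwich scale L G M = mat (dim_row L) (dim_col M)
     (\<lambda>(i, j). \<Sum>k<dim_row G. \<Sum>l<dim_col G. scale (L $$ (i, k) * M $$ (l, j)) (G $$ (k, l)))"

definition direct_sum_mat :: "'a::zero mat \<Rightarrow> 'a mat \<Rightarrow> 'a mat" where
  "direct_sum_mat G H =
     four_block_mat G (0\<^sub>m (dim_row G) (dim_col H)) (0\<^sub>m (dim_row H) (dim_col G)) H"

text \<open>
  The algebra is the subset \<open>B\<close> of a type carrying the algebra operations, with complex
  scalar multiplication \<open>scale\<close>; its unit is the \<open>1\<close> of the type. A single function \<open>nrm\<close>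
  gives the norms on all matrix levels, the level being determined by the size of its
  argument. Only square matrices of positive size with entries in \<open>B\<close> are constrained.
\<close>

locale operator_algebra = vector_space scale
  for scale :: "complex \<Rightarrow> 'a \<Rightarrow> 'a::ring_1" +
  fixes B :: "'a set" and nrm :: "'a mat \<Rightarrow> real"
  assumes scale_mult_left: "scale c a * b = scale c (a * b)"
    and scale_mult_right: "a * scale c b = scale c (a * b)"
    and subspace_carrier: "subspace B"
    and one_closed: "1 \<in> B"
    and mult_closed: "a \<in> B \<Longrightarrow> b \<in> B \<Longrightarrow> a * b \<in> B"
    and nrm_eq_0_iff:
      "0 < n \<Longrightarrow> G \<in> matrices_over n B \<Longrightarrow> nrm G = 0 \<longleftrightarrow> G = 0\<^sub>m n n"
    and nrm_nonneg: "0 < n \<Longrightarrow> G \<in> matrices_over n B \<Longrightarrow> 0 \<le> nrm G"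
    and nrm_scale:
      "0 < n \<Longrightarrow> G \<in> matrices_over n B \<Longrightarrow> nrm (map_mat (scale c) G) = cmod c * nrm G"
    and nrm_triangle:
      "0 < n \<Longrightarrow> G \<in> matrices_over n B \<Longrightarrow> H \<in> matrices_over n B \<Longrightarrow>
         nrm (G + H) \<le> nrm G + nrm H"
    and nrm_sandwich:
      "0 < m \<Longrightarrow> 0 < n \<Longrightarrow> L \<in> carrier_mat m n \<Longrightarrow> G \<in> matrices_over n B \<Longrightarrow>
         M \<in> carrier_mat n m \<Longrightarrow>
         nrm (scalar_sandwich scale L G M) \<le> op_norm L * nrm G * op_norm M"
    and nrm_direct_sum:
      "0 < m \<Longrightarrow> 0 < n \<Longrightarrow> G \<in> matrices_over m B \<Longrightarrow> H \<in> matrices_over n B \<Longrightarrow>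
         nrm (direct_sum_mat G H) = max (nrm G) (nrm H)"
    and nrm_mult:
      "0 < n \<Longrightarrow> G \<in> matrices_over n B \<Longrightarrow> H \<in> matrices_over n B \<Longrightarrow>
         nrm (G * H) \<le> nrm G * nrm H"
    and nrm_one: "nrm (1\<^sub>m 1) = 1"


section \<open>Residual finite dimensionality\<close>

text \<open>
  \<open>(\<pi>(b\<^sub>i\<^sub>j))\<close> as an element of \<open>M\<^sub>n(M\<^sub>k) = M\<^sub>n\<^sub>k\<close>: the \<open>k \<times> k\<close> block in
  position \<open>(i, j)\<close> is \<open>\<pi>(b\<^sub>i\<^sub>j)\<close>.
\<close>

definition amplify :: "nat \<Rightarrow> ('a \<Rightarrow> complex mat) \<Rightarrow> 'a mat \<Rightarrow> complex mat" where
  "amplify k \<pi> G = mat (dim_row G * k) (dim_col G * k)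
     (\<lambda>(i, j). \<pi> (G $$ (i div k, j div k)) $$ (i mod k, j mod k))"

definition completely_contractive_hom ::
  "(complex \<Rightarrow> 'a \<Rightarrow> 'a::ring_1) \<Rightarrow> 'a set \<Rightarrow> ('a mat \<Rightarrow> real) \<Rightarrow> nat \<Rightarrow> ('a \<Rightarrow> complex mat) \<Rightarrow> bool"
where
  "completely_contractive_hom scale B nrm k \<pi> \<longleftrightarrow>
     (\<forall>b\<in>B. \<pi> b \<in> carrier_mat k k) \<and>
     (\<forall>a\<in>B. \<forall>b\<in>B. \<pi> (a + b) = \<pi> a + \<pi> b) \<and>
     (\<forall>c. \<forall>b\<in>B. \<pi> (scale c b) = c \<cdot>\<^sub>m \<pi> b) \<and>
     (\<forall>a\<in>B. \<forall>b\<in>B. \<pi> (a * b) = \<pi> a * \<pi> b) \<and>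
     (\<forall>n>0. \<forall>G\<in>matrices_over n B. op_norm (amplify k \<pi> G) \<le> nrm G)"

text \<open>
  The set below is nonempty (\<open>\<pi> = 0\<close>) and bounded by \<open>nrm G\<close>, so the real-valued \<open>Sup\<close>
  is a genuine supremum.
\<close>

definition RFD ::
  "(complex \<Rightarrow> 'a \<Rightarrow> 'a::ring_1) \<Rightarrow> 'a set \<Rightarrow> ('a mat \<Rightarrow> real) \<Rightarrow> bool" where
  "RFD scale B nrm \<longleftrightarrow>
     (\<forall>n>0. \<forall>G\<in>matrices_over n B.
        nrm G = Sup {op_norm (amplify k \<pi> G) | k \<pi>.
                       0 < k \<and> completely_contractive_hom scale B nrm k \<pi>})"


section \<open>Operator algebras of functions\<close>

definition fun_scale :: "complex \<Rightarrow> ('x \<Rightarrow> complex) \<Rightarrow> ('x \<Rightarrow> complex)" where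
  "fun_scale c f = (\<lambda>x. c * f x)"

text \<open>
  The set on which the functions live is the type \<open>'x\<close>. This excludes only the empty set,
  on which the norm of \<open>1 = 0\<close> could not be \<open>1\<close>. Ring operations on functions are pointwise.
\<close>

locale function_operator_algebra = operator_algebra fun_scale A nrm
  for A :: "('x \<Rightarrow> complex) set" and nrm :: "('x \<Rightarrow> complex) mat \<Rightarrow> real" +
  assumes constants: "(\<lambda>x. c) \<in> A"
    and separates_points: "x \<noteq> y \<Longrightarrow> \<exists>f\<in>A. f x \<noteq> f y"
    and evaluation_bounded: "\<exists>K. \<forall>f\<in>A. cmod (f x) \<le> K * nrm (mat 1 1 (\<lambda>_. f))"

definition vanishing_ideal :: "('x \<Rightarrow> complex) set \<Rightarrow> 'x set \<Rightarrow> ('x \<Rightarrow> complex) set" where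
  "vanishing_ideal A F = {f \<in> A. \<forall>x\<in>F. f x = 0}"

text \<open>The norm of the coset of \<open>G\<close> in \<open>M\<^sub>n(A) / M\<^sub>n(I\<^sub>F)\<close>.\<close>

definition quotient_norm ::
  "('x \<Rightarrow> complex) set \<Rightarrow> (('x \<Rightarrow> complex) mat \<Rightarrow> real) \<Rightarrow> 'x set \<Rightarrow> ('x \<Rightarrow> complex) mat \<Rightarrow> real"
where
  "quotient_norm A nrm F G =
     (INF H \<in> matrices_over (dim_row G) (vanishing_ideal A F). nrm (G + H))"

definition local_algebra ::
  "('x \<Rightarrow> complex) set \<Rightarrow> (('x \<Rightarrow> complex) mat \<Rightarrow> real) \<Rightarrow> bool" where
  "local_algebra A nrm \<longleftrightarrow>
     (\<forall>n>0. \<forall>G\<in>matrices_over n A. nrm G = (SUP F \<in> {F. finite F}. quotient_norm A nrm F G))"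

end

theory Submission
  imports Defs "Jordan_Normal_Form.Determinant"
begin

text \<open>
  Fix a finite \<open>F\<close> and \<open>G\<^sub>0 \<in> M\<^sub>n(A)\<close> whose coset in \<open>M\<^sub>n(A / I\<^sub>F)\<close> has norm greater than
  \<open>1\<close>. The algebra acts diagonally on \<open>\<complex>\<^sup>F \<otimes> \<complex>\<^sup>n\<close>, generated as a module by the unit vectors
  \<open>e\<^sub>1, \<dots>, e\<^sub>n\<close> of \<open>\<complex>\<^sup>n\<close>, and a positive definite form on this space for which the action is
  completely contractive turns it into a homomorphism into \<open>M\<^sub>k\<close>. So one looks for a positive
  functional on quadratic forms that is nonnegative on the convex cone of all
  \<open>|v|\<^sup>2 - |Gv|\<^sup>2 + \<tau> (|G\<^sub>0 e|\<^sup>2 - |e|\<^sup>2)\<close>, where \<open>\<parallel>G\<parallel> \<le> 1\<close> and \<open>\<tau> > 0\<close>. By Hahn--Banach it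
  exists unless some such form is negative definite. In that case
  \<open>|G\<^sub>0 e|\<^sup>2 + |v|\<^sup>2 < |e|\<^sup>2 + |Gv|\<^sup>2\<close>, and a Douglas factorization gives a scalar contraction
  \<open>C\<close> with \<open>(G\<^sub>0 e; v) = C (e; Gv)\<close> on \<open>F\<close>. Applying this on \<open>N\<close> copies of \<open>e\<close> one after
  the other, while reusing the same \<open>v\<close>, yields
  \<open>\<surd>N \<parallel>G\<^sub>0 + I\<^sub>F\<parallel> \<le> \<surd>N + \<parallel>v\<parallel>\<close> for all \<open>N\<close>, a contradiction. This argument uses only the
  BRS axioms, so no Hilbert space representation of the algebra is needed.
\<close>

section \<open>Positive functionals nonnegative on a cone of functions\<close>

text \<open>Only strictly positive multiples are demanded, and 0 need not belong: the members of
  \<open>gram_cone\<close> below carry a strictly positive weight on \<open>excess\<close>.\<close>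

definition fun_cone :: "('s \<Rightarrow> real) set \<Rightarrow> bool" where
  "fun_cone P \<longleftrightarrow> (\<forall>f\<in>P. \<forall>g\<in>P. (\<lambda>s. f s + g s) \<in> P) \<and>
     (\<forall>f\<in>P. \<forall>r>0. (\<lambda>s. r * f s) \<in> P)"

lemma fun_cone_add: "fun_cone P \<Longrightarrow> f \<in> P \<Longrightarrow> g \<in> P \<Longrightarrow> (\<lambda>s. f s + g s) \<in> P"
  by (auto simp: fun_cone_def)

lemma fun_cone_scale: "fun_cone P \<Longrightarrow> f \<in> P \<Longrightarrow> 0 < r \<Longrightarrow> (\<lambda>s. r * f s) \<in> P"
  by (auto simp: fun_cone_def)

lemma fun_cone_Union_chain:
  assumes "subset.chain {P. fun_cone P} \<C>"
  shows "fun_cone (\<Union>\<C>)"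
  unfolding fun_cone_def
proof (intro conjI ballI allI impI)
  fix f g assume "f \<in> \<Union>\<C>" "g \<in> \<Union>\<C>"
  then obtain P Q where "P \<in> \<C>" "Q \<in> \<C>" "f \<in> P" "g \<in> Q" by blast
  moreover from this assms have "P \<subseteq> Q \<or> Q \<subseteq> P" "fun_cone P" "fun_cone Q"
    by (auto simp: subset_chain_def)
  ultimately show "(\<lambda>s. f s + g s) \<in> \<Union>\<C>"
    by (elim disjE) (auto intro!: UnionI fun_cone_add)
next
  fix f and r :: real assume "f \<in> \<Union>\<C>" "0 < r"
  with assms show "(\<lambda>s. r * f s) \<in> \<Union>\<C>"
    by (auto simp: subset_chain_def intro!: bexI fun_cone_scale)
qed

text \<open>Zorn's lemma gives a cone maximal among those containing \<open>P\<close> and avoiding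
  -1. If it missed both \<open>f\<close> and \<open>-f\<close>, adjoining either one would produce
  -1, and a positive combination of the two resulting identities would eliminate \<open>f\<close>
  and put -1 into the maximal cone itself.\<close>

lemma total_fun_cone_extension:
  fixes P :: "('s \<Rightarrow> real) set"
  assumes P: "fun_cone P" and zero: "(\<lambda>_. 0) \<in> P" and neg: "(\<lambda>_. -1) \<notin> P"
  obtains M where "fun_cone M" "P \<subseteq> M" "(\<lambda>_. -1) \<notin> M"
    "\<forall>f. f \<in> M \<or> (\<lambda>s. - f s) \<in> M"
proof -
  define \<A> where "\<A> = {Q. fun_cone Q \<and> P \<subseteq> Q \<and> (\<lambda>_. -1) \<notin> Q}"
  have "\<exists>M\<in>\<A>. \<forall>X\<in>\<A>. M \<subseteq> X \<longrightarrow> X = M"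
  proof (rule subset_Zorn_nonempty)
    show "\<A> \<noteq> {}" using P neg by (auto simp: \<A>_def)
    fix \<C> assume "\<C> \<noteq> {}" and ch: "subset.chain \<A> \<C>"
    then have "subset.chain {P. fun_cone P} \<C>"
      by (auto simp: subset_chain_def \<A>_def)
    from fun_cone_Union_chain[OF this] show "\<Union>\<C> \<in> \<A>"
      using ch \<open>\<C> \<noteq> {}\<close> by (fastforce simp: \<A>_def subset_chain_def)
  qed
  then obtain M where "M \<in> \<A>" and maxM: "\<And>X. X \<in> \<A> \<Longrightarrow> M \<subseteq> X \<Longrightarrow> X = M" by blast
  then have M: "fun_cone M" "P \<subseteq> M" "(\<lambda>_. -1) \<notin> M" by (auto simp: \<A>_def)
  have ext: "\<exists>p\<in>M. \<exists>r>0. \<forall>s. p s + r * f s = -1" if "f \<notin> M" for f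
  proof -
    \<comment> \<open>The cone generated by \<open>M\<close> and \<open>f\<close>. The weight 0 is
      allowed so that \<open>M \<subseteq> Q\<close>; maximality then forces -1 into
      \<open>Q\<close>.\<close>
    define Q where "Q = {g. \<exists>p\<in>M. \<exists>r\<ge>0. \<forall>s. g s = p s + r * f s}"
    have "fun_cone Q"
      unfolding fun_cone_def
    proof (intro conjI ballI allI impI)
      fix g h assume "g \<in> Q" "h \<in> Q"
      then obtain p q r t where "p \<in> M" "q \<in> M" "r \<ge> 0" "t \<ge> 0"
        "\<And>s. g s = p s + r * f s" "\<And>s. h s = q s + t * f s"
        by (auto simp: Q_def)
      then show "(\<lambda>s. g s + h s) \<in> Q"
        unfolding Q_def
        by (intro CollectI bexI[of _ "\<lambda>s. p s + q s"] exI[of _ "r + t"])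
          (auto simp: algebra_simps fun_cone_add M)
    next
      fix g and a :: real assume "g \<in> Q" "0 < a"
      then obtain p r where "p \<in> M" "r \<ge> 0" "\<And>s. g s = p s + r * f s"
        by (auto simp: Q_def)
      with \<open>0 < a\<close> show "(\<lambda>s. a * g s) \<in> Q"
        unfolding Q_def
        by (intro CollectI bexI[of _ "\<lambda>s. a * p s"] exI[of _ "a * r"])
          (auto simp: algebra_simps fun_cone_scale M)
    qed
    moreover have "M \<subseteq> Q" by (auto simp: Q_def intro!: bexI exI[of _ "0::real"])
    moreover have "f \<in> Q"
      unfolding Q_def using zero M
      by (intro CollectI bexI[of _ "\<lambda>_. 0"] exI[of _ 1]) auto
    ultimately have "(\<lambda>_. -1) \<in> Q" using maxM[of Q] that M by (auto simp: \<A>_def)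
    then obtain p r where pr: "p \<in> M" "r \<ge> 0" "\<And>s. -1 = p s + r * f s"
      by (auto simp: Q_def)
    have "r \<noteq> 0"
    proof
      assume "r = 0"
      with pr have "p = (\<lambda>_. -1)" by (auto simp: fun_eq_iff)
      with pr M show False by simp
    qed
    with pr show ?thesis by (intro bexI[of _ p] exI[of _ r]) auto
  qed
  have "f \<in> M \<or> (\<lambda>s. - f s) \<in> M" for f
  proof (rule ccontr)
    assume "\<not> ?thesis"
    then obtain p q r t where pq: "p \<in> M" "q \<in> M" "r > 0" "t > 0"
      "\<And>s. p s + r * f s = -1" "\<And>s. q s + t * - f s = -1"
      using ext[of f] ext[of "\<lambda>s. - f s"] by blast
    \<comment> \<open>The weights \<open>t\<close> and \<open>r\<close> cancel the terms in
      \<open>f\<close>, and the factor \<open>1 / (r + t)\<close> normalizes the constant to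
      -1.\<close>
    have "(\<lambda>s. 1 / (r + t) * (t * p s + r * q s)) \<in> M"
      using pq by (intro fun_cone_scale fun_cone_add M) auto
    moreover have "1 / (r + t) * (t * p s + r * q s) = -1" for s
    proof -
      have p: "p s = -1 - r * f s" and q: "q s = -1 + t * f s"
        using pq(5)[of s] pq(6)[of s] by (simp_all add: algebra_simps)
      have "t * p s + r * q s = - (r + t)" unfolding p q by (simp add: algebra_simps)
      then show ?thesis using pq by (simp add: field_simps)
    qed
    ultimately show False using M by simp
  qed
  with M that show thesis by blast
qed

section \<open>Positive functionals on bounded functions\<close>

definition bounded_fun :: "'s set \<Rightarrow> ('s \<Rightarrow> real) \<Rightarrow> bool" where
  "bounded_fun S f \<longleftrightarrow> (\<exists>K. \<forall>s\<in>S. \<bar>f s\<bar> \<le> K)"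

lemma bounded_fun_add:
  assumes "bounded_fun S f" "bounded_fun S g"
  shows "bounded_fun S (\<lambda>s. f s + g s)"
proof -
  obtain K L where "\<forall>s\<in>S. \<bar>f s\<bar> \<le> K" "\<forall>s\<in>S. \<bar>g s\<bar> \<le> L"
    using assms by (auto simp: bounded_fun_def)
  then have "\<forall>s\<in>S. \<bar>f s + g s\<bar> \<le> K + L"
    by (auto intro: order_trans[OF abs_triangle_ineq add_mono])
  then show ?thesis by (auto simp: bounded_fun_def)
qed

lemma bounded_fun_scale: "bounded_fun S f \<Longrightarrow> bounded_fun S (\<lambda>s. r * f s)"
  unfolding bounded_fun_def by (metis abs_ge_zero abs_mult mult_left_mono)

lemma bounded_fun_sum:
  "finite I \<Longrightarrow> (\<And>i. i \<in> I \<Longrightarrow> bounded_fun S (f i)) \<Longrightarrow> bounded_fun S (\<lambda>s. \<Sum>i\<in>I. f i s)"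
proof (induction I rule: finite_induct)
  case empty
  then show ?case by (auto simp: bounded_fun_def)
qed (auto intro: bounded_fun_add)

text \<open>A finitely additive mean over \<open>S\<close>. Functions live on the whole type, but by
  positivity only their values on \<open>S\<close> matter; nothing is said about functions unbounded
  on \<open>S\<close>.\<close>

locale positive_functional =
  fixes S :: "'s set" and \<phi> :: "('s \<Rightarrow> real) \<Rightarrow> real"
  assumes add: "bounded_fun S f \<Longrightarrow> bounded_fun S g \<Longrightarrow> \<phi> (\<lambda>s. f s + g s) = \<phi> f + \<phi> g"
    and scale: "bounded_fun S f \<Longrightarrow> \<phi> (\<lambda>s. r * f s) = r * \<phi> f"
    and nonneg: "bounded_fun S f \<Longrightarrow> (\<And>s. s \<in> S \<Longrightarrow> 0 \<le> f s) \<Longrightarrow> 0 \<le> \<phi> f"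
    and one: "bounded_fun S f \<Longrightarrow> (\<And>s. s \<in> S \<Longrightarrow> f s = 1) \<Longrightarrow> \<phi> f = 1"
begin

lemma zero: "\<phi> (\<lambda>_. 0) = 0"
  using scale[of "\<lambda>_. 0" 0] by (auto simp: bounded_fun_def)

lemma diff:
  assumes "bounded_fun S f" "bounded_fun S g"
  shows "\<phi> (\<lambda>s. f s - g s) = \<phi> f - \<phi> g"
  using add[OF assms(1) bounded_fun_scale[OF assms(2), of "-1"]] scale[OF assms(2), of "-1"] by simp

lemma sum:
  assumes "finite I" "\<And>i. i \<in> I \<Longrightarrow> bounded_fun S (f i)"
  shows "\<phi> (\<lambda>s. \<Sum>i\<in>I. f i s) = (\<Sum>i\<in>I. \<phi> (f i))"
  using assms
  by (induction I rule: finite_induct) (simp_all add: zero add bounded_fun_sum)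

end

text \<open>Hahn--Banach separation of \<open>C\<close> from the functions at most -1 on
  \<open>S\<close>. A total cone \<open>M\<close> containing \<open>C\<close> and all functions
  nonnegative on \<open>S\<close> acts as an order; the value of \<phi> at \<open>f\<close> is the
  number \<open>r\<close> at which \<open>f - r\<close> leaves \<open>M\<close>.\<close>

lemma positive_functional_on_cone:
  fixes C :: "('s \<Rightarrow> real) set"
  assumes C: "fun_cone C" and S: "S \<noteq> {}"
    and small: "\<And>f. f \<in> C \<Longrightarrow> \<exists>s\<in>S. -1 < f s"
  obtains \<phi> where "positive_functional S \<phi>"
    "\<And>f. bounded_fun S f \<Longrightarrow> f \<in> C \<Longrightarrow> 0 \<le> \<phi> f"
proof -
  \<comment> \<open>The upward closure of \<open>C\<close> together with 0 for the order on
    \<open>S\<close>. Including 0 makes every function nonnegative on \<open>S\<close> a member;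
    \<open>small\<close> and \<open>S \<noteq> {}\<close> exclude -1.\<close>
  define P where "P = {f. \<exists>c\<in>insert (\<lambda>_. 0) C. \<forall>s\<in>S. c s \<le> f s}"
  have "fun_cone P"
    unfolding fun_cone_def
  proof (intro conjI ballI allI impI)
    fix f g assume "f \<in> P" "g \<in> P"
    then obtain c e where c: "c \<in> insert (\<lambda>_. 0) C" "\<forall>s\<in>S. c s \<le> f s"
      and e: "e \<in> insert (\<lambda>_. 0) C" "\<forall>s\<in>S. e s \<le> g s"
      by (auto simp: P_def)
    have "(\<lambda>s. c s + e s) \<in> insert (\<lambda>_. 0) C"
      using c(1) e(1) fun_cone_add[OF C] by auto
    then show "(\<lambda>s. f s + g s) \<in> P"
      unfolding P_def using c(2) e(2)
      by (intro CollectI bexI[of _ "\<lambda>s. c s + e s"]) (auto intro: add_mono)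
  next
    fix f and a :: real assume "f \<in> P" "0 < a"
    then obtain c where c: "c \<in> insert (\<lambda>_. 0) C" "\<forall>s\<in>S. c s \<le> f s"
      by (auto simp: P_def)
    have "(\<lambda>s. a * c s) \<in> insert (\<lambda>_. 0) C"
      using c(1) fun_cone_scale[OF C _ \<open>0 < a\<close>] by auto
    then show "(\<lambda>s. a * f s) \<in> P"
      unfolding P_def using c(2) \<open>0 < a\<close>
      by (intro CollectI bexI[of _ "\<lambda>s. a * c s"]) auto
  qed
  moreover have "(\<lambda>_. 0) \<in> P" by (auto simp: P_def)
  moreover have "(\<lambda>_. -1) \<notin> P" using S small by (force simp: P_def)
  ultimately obtain M where M: "fun_cone M" "P \<subseteq> M" "(\<lambda>_. -1) \<notin> M"
    and total: "\<forall>f. f \<in> M \<or> (\<lambda>s. - f s) \<in> M"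
    by (rule total_fun_cone_extension)
  have CM: "f \<in> M" if "f \<in> C" for f
    using that M(2) by (auto simp: P_def)
  have nonneg: "f \<in> M" if "\<And>s. s \<in> S \<Longrightarrow> 0 \<le> f s" for f
    using that M(2) by (auto simp: P_def)
  \<comment> \<open>A negative value on \<open>S\<close> could be scaled to -1 there; adding a
    function that vanishes on \<open>S\<close> then corrects the values off \<open>S\<close> and
    yields the excluded constant -1.\<close>
  have const: "0 \<le> c" if "f \<in> M" "\<And>s. s \<in> S \<Longrightarrow> f s = c" for c :: real and f
  proof (rule ccontr)
    assume "\<not> 0 \<le> c"
    then have "c < 0" by simp
    then have "(\<lambda>s. 1 / (-c) * f s) \<in> M"
      using that by (intro fun_cone_scale M) auto
    moreover have "(\<lambda>s. -1 - 1 / (-c) * f s) \<in> M"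
      using \<open>c < 0\<close> that(2) by (intro nonneg) simp
    ultimately have "(\<lambda>s. 1 / (-c) * f s + (-1 - 1 / (-c) * f s)) \<in> M"
      by (rule fun_cone_add[OF M(1)])
    then show False using M by simp
  qed
  \<comment> \<open>\<open>D f x\<close> says that \<open>f\<close> and \<open>x\<close> are equal
    up to every positive constant in the order of \<open>M\<close>. The slack \<epsilon> is there
    because \<open>M\<close> need not be closed.\<close>
  define D where "D f x \<longleftrightarrow> (\<forall>\<epsilon>>0. (\<lambda>s. f s - x + \<epsilon>) \<in> M \<and> (\<lambda>s. x + \<epsilon> - f s) \<in> M)"
    for f :: "'s \<Rightarrow> real" and x
  have D_le: "x \<le> y" if "D f x" "D f y" for f x y
  proof (rule field_le_epsilon)
    fix e :: real assume "0 < e"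
    then have "(\<lambda>s. f s - x + e/2) \<in> M" "(\<lambda>s. y + e/2 - f s) \<in> M"
      using that by (simp_all add: D_def)
    from const[OF fun_cone_add[OF M(1) this], of "y + e - x"] show "x \<le> y + e" by simp
  qed
  have D_ex: "\<exists>x. D f x" if f: "bounded_fun S f" for f
  proof -
    obtain K where K: "\<And>s. s \<in> S \<Longrightarrow> \<bar>f s\<bar> \<le> K"
      using f by (auto simp: bounded_fun_def)
    \<comment> \<open>The lower cut of \<open>f\<close>; its supremum is the value of \<phi> at
      \<open>f\<close>.\<close>
    define R where "R = {r. (\<lambda>s. f s - r) \<in> M}"
    have "f s - (-K) \<ge> 0" if "s \<in> S" for s using K[OF that] by linarith
    then have ne: "-K \<in> R" unfolding R_def by (auto intro!: nonneg)
    have ub: "r \<le> K" if "r \<in> R" for r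
    proof -
      have "(\<lambda>s. K - f s) \<in> M" using K by (intro nonneg) (simp add: abs_le_iff)
      moreover have "(\<lambda>s. f s - r) \<in> M" using that by (simp add: R_def)
      ultimately have "(\<lambda>s. (K - f s) + (f s - r)) \<in> M" by (rule fun_cone_add[OF M(1)])
      from const[OF this, of "K - r"] show ?thesis by simp
    qed
    then have bdd: "bdd_above R" by (auto simp: bdd_above_def)
    have "D f (Sup R)"
      unfolding D_def
    proof (intro allI impI conjI)
      fix e :: real assume e: "0 < e"
      then obtain r where r: "r \<in> R" "Sup R - e < r"
        using less_cSupD[of R "Sup R - e"] ne by auto
      have "(\<lambda>_. r - Sup R + e) \<in> M" using r by (intro nonneg) simp
      moreover have "(\<lambda>s. f s - r) \<in> M" using r by (simp add: R_def)
      ultimately have "(\<lambda>s. (r - Sup R + e) + (f s - r)) \<in> M" by (rule fun_cone_add[OF M(1)])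
      then show "(\<lambda>s. f s - Sup R + e) \<in> M" by (simp add: algebra_simps)
      \<comment> \<open>Totality of \<open>M\<close> turns the failure of
        \<open>f - (Sup R + e) \<in> M\<close> into membership of the negative.\<close>
      have "Sup R + e \<notin> R" using cSup_upper[OF _ bdd, of "Sup R + e"] e by auto
      then show "(\<lambda>s. Sup R + e - f s) \<in> M"
        using total[rule_format, of "\<lambda>s. f s - (Sup R + e)"] by (auto simp: R_def)
    qed
    then show ?thesis ..
  qed
  define \<phi> where "\<phi> f = (SOME x. D f x)" for f
  have D_phi: "D f (\<phi> f)" if "bounded_fun S f" for f
    unfolding \<phi>_def using D_ex[OF that] by (rule someI_ex)
  have phi_eq: "\<phi> f = x" if "D f x" for f x
  proof -
    have "D f (\<phi> f)" unfolding \<phi>_def using that by (rule someI)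
    with that D_le show ?thesis by (auto intro: antisym)
  qed
  have phi_ge: "0 \<le> \<phi> f" if "bounded_fun S f" "f \<in> M" for f
  proof (rule field_le_epsilon)
    fix e :: real assume "0 < e"
    then have "(\<lambda>s. \<phi> f + e - f s) \<in> M"
      using that D_phi by (simp add: D_def)
    from const[OF fun_cone_add[OF M(1) this that(2)], of "\<phi> f + e"] show "0 \<le> \<phi> f + e" by simp
  qed
  have add: "\<phi> (\<lambda>s. f s + g s) = \<phi> f + \<phi> g" if fg: "bounded_fun S f" "bounded_fun S g" for f g
  proof (rule phi_eq, unfold D_def, intro allI impI conjI)
    fix e :: real assume "0 < e"
    then have *: "(\<lambda>s. (f s - \<phi> f + e/2) + (g s - \<phi> g + e/2)) \<in> M"
      "(\<lambda>s. (\<phi> f + e/2 - f s) + (\<phi> g + e/2 - g s)) \<in> M"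
      using D_phi[OF fg(1)] D_phi[OF fg(2)]
      by (safe intro!: fun_cone_add[OF M(1), where f = "\<lambda>s. f s - \<phi> f + e/2"]
          fun_cone_add[OF M(1), where f = "\<lambda>s. \<phi> f + e/2 - f s"]) (simp_all add: D_def)
    have "f s - \<phi> f + e/2 + (g s - \<phi> g + e/2) = f s + g s - (\<phi> f + \<phi> g) + e"
      "\<phi> f + e/2 - f s + (\<phi> g + e/2 - g s) = \<phi> f + \<phi> g + e - (f s + g s)" for s
      by (simp_all add: field_simps)
    with * show "(\<lambda>s. f s + g s - (\<phi> f + \<phi> g) + e) \<in> M"
      "(\<lambda>s. \<phi> f + \<phi> g + e - (f s + g s)) \<in> M" by simp_all
  qed
  have zero: "\<phi> (\<lambda>_. 0) = 0"
    by (rule phi_eq) (auto simp: D_def intro: nonneg)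
  have pos: "\<phi> (\<lambda>s. r * f s) = r * \<phi> f" if f: "bounded_fun S f" and "0 < r" for f r
  proof (rule phi_eq, unfold D_def, intro allI impI conjI)
    fix e :: real assume "0 < e"
    with \<open>0 < r\<close> have "(\<lambda>s. r * (f s - \<phi> f + e/r)) \<in> M" "(\<lambda>s. r * (\<phi> f + e/r - f s)) \<in> M"
      using D_phi[OF f] by (auto intro!: fun_cone_scale M simp: D_def)
    with \<open>0 < r\<close> show "(\<lambda>s. r * f s - r * \<phi> f + e) \<in> M" "(\<lambda>s. r * \<phi> f + e - r * f s) \<in> M"
      by (simp_all add: algebra_simps)
  qed
  have minus: "\<phi> (\<lambda>s. - f s) = - \<phi> f" if f: "bounded_fun S f" for f
  proof -
    have "bounded_fun S (\<lambda>s. - f s)" using bounded_fun_scale[OF f, of "-1"] by simp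
    from add[OF f this] zero show ?thesis by simp
  qed
  have scale: "\<phi> (\<lambda>s. r * f s) = r * \<phi> f" if f: "bounded_fun S f" for f r
  proof (cases r "0::real" rule: linorder_cases)
    case less
    have "bounded_fun S (\<lambda>s. - r * f s)"
      by (rule bounded_fun_scale[OF f])
    from minus[OF this] pos[OF f, of "- r"] less show ?thesis by simp
  qed (use pos zero f in auto)
  have "\<phi> f = 1" if "bounded_fun S f" "\<And>s. s \<in> S \<Longrightarrow> f s = 1" for f
    by (rule phi_eq) (auto simp: D_def that intro!: nonneg)
  with add scale phi_ge nonneg have "positive_functional S \<phi>" by unfold_locales auto
  with phi_ge CM that show thesis by blast
qed

section \<open>Scalar matrices\<close>

lemma cvec_norm_power2: "(cvec_norm v)\<^sup>2 = (\<Sum>i<dim_vec v. (cmod (v $ i))\<^sup>2)"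
  by (simp add: cvec_norm_def L2_set_def sum_nonneg)

lemma cvec_norm_nonneg: "0 \<le> cvec_norm v"
  by (simp add: cvec_norm_def)

lemma cvec_norm_smult: "cvec_norm (c \<cdot>\<^sub>v v) = cmod c * cvec_norm v"
proof (rule power2_eq_imp_eq)
  show "(cvec_norm (c \<cdot>\<^sub>v v))\<^sup>2 = (cmod c * cvec_norm v)\<^sup>2"
    by (simp add: cvec_norm_power2 power_mult_distrib norm_mult sum_distrib_left)
qed (auto simp: cvec_norm_nonneg)

lemma cvec_norm_eq_0_iff: "v \<in> carrier_vec n \<Longrightarrow> cvec_norm v = 0 \<longleftrightarrow> v = 0\<^sub>v n"
  by (auto simp: cvec_norm_def L2_set_eq_0_iff)

lemma cvec_norm_zero [simp]: "cvec_norm (0\<^sub>v n) = 0"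
  by (simp add: cvec_norm_def L2_set_0')

lemma cmod_sum_cnj_mult_le:
  assumes "dim_vec u = n" "dim_vec v = n"
  shows "cmod (\<Sum>i<n. cnj (u $ i) * v $ i) \<le> cvec_norm u * cvec_norm v"
proof -
  have "cmod (\<Sum>i<n. cnj (u $ i) * v $ i) \<le> (\<Sum>i<n. \<bar>cmod (u $ i)\<bar> * \<bar>cmod (v $ i)\<bar>)"
    by (rule sum_norm_le) (simp add: norm_mult)
  also have "\<dots> \<le> cvec_norm u * cvec_norm v"
    unfolding cvec_norm_def assms by (rule L2_set_mult_ineq)
  finally show ?thesis .
qed

lemma sum_cnj_mult_self:
  "dim_vec v = n \<Longrightarrow> (\<Sum>i<n. cnj (v $ i) * v $ i) = complex_of_real ((cvec_norm v)\<^sup>2)"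
  unfolding cvec_norm_power2 of_real_sum
  by (intro sum.cong) (simp_all add: complex_norm_square[symmetric] mult.commute[of "cnj _"])

lemma mult_mat_vec_nth:
  "i < dim_row A \<Longrightarrow> dim_col A = n \<Longrightarrow> dim_vec v = n \<Longrightarrow> (A *\<^sub>v v) $ i = (\<Sum>j<n. A $$ (i, j) * v $ j)"
  by (simp add: scalar_prod_def atLeast0LessThan)

lemma mult_mat_nth:
  "A \<in> carrier_mat m n \<Longrightarrow> B \<in> carrier_mat n p \<Longrightarrow> i < m \<Longrightarrow> j < p \<Longrightarrow>
    (A * B) $$ (i, j) = (\<Sum>k<n. A $$ (i, k) * B $$ (k, j))"
  by (auto simp: scalar_prod_def atLeast0LessThan intro!: sum.cong)

lemma op_norm_bdd_above:
  "bdd_above ((\<lambda>v. cvec_norm (L *\<^sub>v v)) ` {v \<in> carrier_vec (dim_col L). cvec_norm v \<le> 1})"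
proof (rule bdd_aboveI2)
  fix v assume v: "v \<in> {v \<in> carrier_vec (dim_col L). cvec_norm v \<le> 1}"
  have "cmod (v $ j) \<le> 1" if "j < dim_col L" for j
  proof -
    have "cmod (v $ j) \<le> cvec_norm v"
      unfolding cvec_norm_def using that v by (intro member_le_L2_set) auto
    with v show ?thesis by simp
  qed
  then have le: "cmod ((L *\<^sub>v v) $ i) \<le> (\<Sum>j<dim_col L. cmod (L $$ (i, j)))" if "i < dim_row L" for i
    using that v
    by (auto simp: mult_mat_vec_nth[where n = "dim_col L"] norm_mult
        simp del: index_mult_mat_vec intro!: sum_norm_le mult_left_le)
  have "cvec_norm (L *\<^sub>v v) \<le> (\<Sum>i<dim_row L. cmod ((L *\<^sub>v v) $ i))"
    unfolding cvec_norm_def dim_mult_mat_vec by (rule L2_set_le_sum) simp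
  also have "\<dots> \<le> (\<Sum>i<dim_row L. \<Sum>j<dim_col L. cmod (L $$ (i, j)))"
    using le by (intro sum_mono) auto
  finally show "cvec_norm (L *\<^sub>v v) \<le> (\<Sum>i<dim_row L. \<Sum>j<dim_col L. cmod (L $$ (i, j)))" .
qed

lemma op_norm_leI:
  assumes "0 \<le> c" "\<And>v. v \<in> carrier_vec (dim_col L) \<Longrightarrow> cvec_norm (L *\<^sub>v v) \<le> c * cvec_norm v"
  shows "op_norm L \<le> c"
  unfolding op_norm_def
proof (rule cSUP_least)
  show "{v \<in> carrier_vec (dim_col L). cvec_norm v \<le> 1} \<noteq> {}"
    by (auto intro!: exI[of _ "0\<^sub>v (dim_col L)"])
  fix v assume "v \<in> {v \<in> carrier_vec (dim_col L). cvec_norm v \<le> 1}"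
  with assms show "cvec_norm (L *\<^sub>v v) \<le> c"
    by (auto intro: order_trans[OF _ mult_left_le])
qed

lemma cvec_norm_mult_le:
  assumes v: "v \<in> carrier_vec (dim_col L)"
  shows "cvec_norm (L *\<^sub>v v) \<le> op_norm L * cvec_norm v"
proof (cases "cvec_norm v = 0")
  case True
  with v have "v = 0\<^sub>v (dim_col L)" by (simp add: cvec_norm_eq_0_iff)
  moreover have "L *\<^sub>v 0\<^sub>v (dim_col L) = 0\<^sub>v (dim_row L)" by auto
  ultimately show ?thesis by simp
next
  case False
  with cvec_norm_nonneg[of v] have pos: "0 < cvec_norm v" by simp
  define w where "w = complex_of_real (1 / cvec_norm v) \<cdot>\<^sub>v v"
  have "cvec_norm w = 1" using pos by (simp add: w_def cvec_norm_smult norm_divide)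
  with v have "cvec_norm (L *\<^sub>v w) \<le> op_norm L"
    unfolding op_norm_def by (intro cSUP_upper op_norm_bdd_above) (auto simp: w_def)
  moreover have "L *\<^sub>v w = complex_of_real (1 / cvec_norm v) \<cdot>\<^sub>v (L *\<^sub>v v)"
    unfolding w_def using v by (intro mult_mat_vec[of _ "dim_row L" "dim_col L"]) auto
  ultimately show ?thesis using pos by (simp add: cvec_norm_smult norm_divide field_simps)
qed

lemma op_norm_nonneg: "0 \<le> op_norm L"
proof -
  have "0\<^sub>v (dim_col L) \<in> {v \<in> carrier_vec (dim_col L). cvec_norm v \<le> 1}"
    by simp
  from cSUP_upper[OF this op_norm_bdd_above] show ?thesis
    unfolding op_norm_def using cvec_norm_nonneg order_trans by blast
qed

section \<open>Douglas and Cholesky factorizations\<close>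

lemma injective_mat_inverse:
  fixes A :: "'a::field mat"
  assumes A: "A \<in> carrier_mat n n"
    and inj: "\<And>v. v \<in> carrier_vec n \<Longrightarrow> A *\<^sub>v v = 0\<^sub>v n \<Longrightarrow> v = 0\<^sub>v n"
  obtains B where "B \<in> carrier_mat n n" "A * B = 1\<^sub>m n" "B * A = 1\<^sub>m n"
proof -
  have "det A \<noteq> 0" using det_0_iff_vec_prod_zero[OF A] inj by blast
  from det_non_zero_imp_unit[OF A this] that show thesis
    by (auto simp: Units_def ring_mat_def)
qed

text \<open>The defining identity of the adjoint, with the adjoint of \<open>B\<close> written out
  entrywise.\<close>

lemma sum_adjoint_mat:
  assumes B: "B \<in> carrier_mat p d" and y: "y \<in> carrier_vec d" and x: "x \<in> carrier_vec p"
  shows "(\<Sum>i<d. cnj (y $ i) * (mat d p (\<lambda>(i, r). cnj (B $$ (r, i))) *\<^sub>v x) $ i)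
    = (\<Sum>r<p. cnj ((B *\<^sub>v y) $ r) * x $ r)"
proof -
  have "(\<Sum>i<d. cnj (y $ i) * (mat d p (\<lambda>(i, r). cnj (B $$ (r, i))) *\<^sub>v x) $ i)
      = (\<Sum>i<d. \<Sum>r<p. cnj (y $ i) * cnj (B $$ (r, i)) * x $ r)"
    using x by (simp add: mult_mat_vec_nth sum_distrib_left mult.assoc del: index_mult_mat_vec)
  also have "\<dots> = (\<Sum>r<p. \<Sum>i<d. cnj (y $ i) * cnj (B $$ (r, i)) * x $ r)"
    by (rule sum.swap)
  also have "\<dots> = (\<Sum>r<p. (\<Sum>i<d. cnj (y $ i) * cnj (B $$ (r, i))) * x $ r)"
    by (simp add: sum_distrib_right)
  also have "\<dots> = (\<Sum>r<p. cnj ((B *\<^sub>v y) $ r) * x $ r)"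
    using B y by (intro sum.cong) (simp_all add: mult_mat_vec_nth mult.commute[of "cnj (y $ _)"]
        del: index_mult_mat_vec)
  finally show ?thesis .
qed

text \<open>Douglas factorization; strictness makes \<open>b\<^sup>*b\<close> invertible, so \<open>C = a (b\<^sup>*b)\<^sup>-\<^sup>1 b\<^sup>*\<close> works.\<close>

lemma strict_gram_factorization:
  fixes a b :: "nat \<Rightarrow> nat \<Rightarrow> complex"
  assumes less: "\<And>y. \<exists>i<d. y i \<noteq> 0 \<Longrightarrow>
    (\<Sum>r<p. (cmod (\<Sum>i<d. a r i * y i))\<^sup>2) < (\<Sum>r<p. (cmod (\<Sum>i<d. b r i * y i))\<^sup>2)"
  obtains C where "C \<in> carrier_mat p p" "op_norm C \<le> 1"
    "\<And>r i. r < p \<Longrightarrow> i < d \<Longrightarrow> a r i = (\<Sum>s<p. C $$ (r, s) * b s i)"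
proof -
  define A where "A = mat p d (\<lambda>(r, i). a r i)"
  define B where "B = mat p d (\<lambda>(r, i). b r i)"
  define B' where "B' = mat d p (\<lambda>(i, r). cnj (B $$ (r, i)))"
  have [simp]: "A \<in> carrier_mat p d" "B \<in> carrier_mat p d" "B' \<in> carrier_mat d p"
    by (auto simp: A_def B_def B'_def)
  have normA: "(cvec_norm (A *\<^sub>v y))\<^sup>2 = (\<Sum>r<p. (cmod (\<Sum>i<d. a r i * y $ i))\<^sup>2)"
    and normB: "(cvec_norm (B *\<^sub>v y))\<^sup>2 = (\<Sum>r<p. (cmod (\<Sum>i<d. b r i * y $ i))\<^sup>2)"
    if "y \<in> carrier_vec d" for y
    using that by (auto simp: cvec_norm_power2 A_def B_def mult_mat_vec_nth simp del: index_mult_mat_vec)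
  have less': "(cvec_norm (A *\<^sub>v y))\<^sup>2 < (cvec_norm (B *\<^sub>v y))\<^sup>2"
    if "y \<in> carrier_vec d" "y \<noteq> 0\<^sub>v d" for y
    unfolding normA[OF that(1)] normB[OF that(1)] using that by (intro less) auto
  have le: "cvec_norm (A *\<^sub>v y) \<le> cvec_norm (B *\<^sub>v y)" if "y \<in> carrier_vec d" for y
  proof (cases "y = 0\<^sub>v d")
    case True
    then have "A *\<^sub>v y = 0\<^sub>v p" by (auto simp: A_def)
    then show ?thesis by (simp add: cvec_norm_nonneg)
  next
    case False
    from less'[OF that this] show ?thesis
      using power2_le_imp_le[OF less_imp_le] cvec_norm_nonneg by blast
  qed
  \<comment> \<open>A kernel vector \<open>v\<close> of \<open>B' * B\<close> satisfies
    \<open>B v = 0\<close>; for nonzero \<open>v\<close> strictness would make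
    \<open>|A v|^2\<close> negative.\<close>
  obtain N where N: "N \<in> carrier_mat d d" "N * (B' * B) = 1\<^sub>m d" "B' * B * N = 1\<^sub>m d"
  proof (rule injective_mat_inverse)
    show "B' * B \<in> carrier_mat d d" by (rule mult_carrier_mat[of _ d p]) simp_all
    fix v assume v: "v \<in> carrier_vec d" and 0: "B' * B *\<^sub>v v = 0\<^sub>v d"
    have Bv: "B *\<^sub>v v \<in> carrier_vec p" using v by (intro mult_mat_vec_carrier[of _ p d]) simp_all
    have "B' *\<^sub>v (B *\<^sub>v v) = 0\<^sub>v d" using 0 v by (simp add: assoc_mult_mat_vec[of _ d p _ d])
    then have "(\<Sum>r<p. cnj ((B *\<^sub>v v) $ r) * (B *\<^sub>v v) $ r) = 0"
      using sum_adjoint_mat[OF \<open>B \<in> carrier_mat p d\<close> v Bv, folded B'_def]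
      by (simp del: index_mult_mat_vec)
    then have "complex_of_real ((cvec_norm (B *\<^sub>v v))\<^sup>2) = 0"
      using sum_cnj_mult_self[OF carrier_vecD[OF Bv]] by (simp del: index_mult_mat_vec)
    then have "(cvec_norm (B *\<^sub>v v))\<^sup>2 = 0" by simp
    then show "v = 0\<^sub>v d"
      using less'[OF v] zero_le_power2[of "cvec_norm (A *\<^sub>v v)"] by fastforce
  qed (use that in auto)
  define C where "C = A * (N * B')"
  have C: "C \<in> carrier_mat p p" unfolding C_def
    by (intro mult_carrier_mat[of _ p d] mult_carrier_mat[of _ d d] N) simp_all
  have "C * B = A * (N * B' * B)" unfolding C_def
    by (rule assoc_mult_mat[of _ p d _ p _ d]) (auto intro!: mult_carrier_mat[of _ d d] N)
  also have "N * B' * B = N * (B' * B)"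
    by (rule assoc_mult_mat[of _ d d _ p _ d]) (auto intro: N)
  finally have "C * B = A * (N * (B' * B))" .
  then have CB: "C * B = A" using N right_mult_one_mat[OF \<open>A \<in> carrier_mat p d\<close>] by simp
  show thesis
  proof (rule that[OF C])
    show "op_norm C \<le> 1"
    proof (rule op_norm_leI)
      fix x :: "complex vec" assume "x \<in> carrier_vec (dim_col C)"
      then have x: "x \<in> carrier_vec p" using C by simp
      \<comment> \<open>\<open>y\<close> solves the normal equations of \<open>B y = x\<close>, so
        \<open>B y\<close> is the orthogonal projection of \<open>x\<close> onto the range of
        \<open>B\<close>. Hence \<open>|C x| = |A y| <= |B y| <= |x|\<close>, the last step by
        Cauchy--Schwarz.\<close>
      define y where "y = N *\<^sub>v (B' *\<^sub>v x)"
      have B'x: "B' *\<^sub>v x \<in> carrier_vec d" using x by (intro mult_mat_vec_carrier[of _ d p]) simp_all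
      have y: "y \<in> carrier_vec d" unfolding y_def by (rule mult_mat_vec_carrier[OF N(1) B'x])
      have By: "B *\<^sub>v y \<in> carrier_vec p" using y by (intro mult_mat_vec_carrier[of _ p d]) simp_all
      have Cx: "C *\<^sub>v x = A *\<^sub>v y" unfolding C_def y_def using N x
        by (simp add: assoc_mult_mat_vec[of _ p d _ p] assoc_mult_mat_vec[of _ d d _ p])
      have "B' *\<^sub>v (B *\<^sub>v y) = B' * B *\<^sub>v y"
        by (rule assoc_mult_mat_vec[of _ d p _ d, symmetric]) (simp_all add: y)
      also have "\<dots> = B' * B * N *\<^sub>v (B' *\<^sub>v x)"
        unfolding y_def by (rule assoc_mult_mat_vec[of _ d d _ d, symmetric])
          (intro mult_carrier_mat[of _ d p] N B'x, simp_all add: N B'x)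
      finally have B'By: "B' *\<^sub>v (B *\<^sub>v y) = B' *\<^sub>v x" using N B'x by simp
      have "complex_of_real ((cvec_norm (B *\<^sub>v y))\<^sup>2) = (\<Sum>r<p. cnj ((B *\<^sub>v y) $ r) * (B *\<^sub>v y) $ r)"
        using sum_cnj_mult_self[OF carrier_vecD[OF By]] by (simp del: index_mult_mat_vec)
      also have "\<dots> = (\<Sum>r<p. cnj ((B *\<^sub>v y) $ r) * x $ r)"
        using sum_adjoint_mat[OF \<open>B \<in> carrier_mat p d\<close> y By, folded B'_def]
          sum_adjoint_mat[OF \<open>B \<in> carrier_mat p d\<close> y x, folded B'_def] B'By
        by (simp del: index_mult_mat_vec)
      finally have "cmod (complex_of_real ((cvec_norm (B *\<^sub>v y))\<^sup>2)) = cmod (\<Sum>r<p. cnj ((B *\<^sub>v y) $ r) * x $ r)"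
        by (rule arg_cong)
      then have "(cvec_norm (B *\<^sub>v y))\<^sup>2 = cmod (\<Sum>r<p. cnj ((B *\<^sub>v y) $ r) * x $ r)"
        by (simp only: norm_of_real abs_power2)
      also have "\<dots> \<le> cvec_norm (B *\<^sub>v y) * cvec_norm x"
        using x by (intro cmod_sum_cnj_mult_le) (auto simp: B_def)
      finally have "cvec_norm (B *\<^sub>v y) \<le> cvec_norm x"
        using cvec_norm_nonneg[of "B *\<^sub>v y"] cvec_norm_nonneg[of x]
        by (cases "cvec_norm (B *\<^sub>v y) = 0") (auto simp: power2_eq_square)
      with le[OF y] show "cvec_norm (C *\<^sub>v x) \<le> 1 * cvec_norm x" by (simp add: Cx)
    qed simp
    fix r i assume ri: "r < p" "i < d"
    have "A $$ (r, i) = (\<Sum>s<p. C $$ (r, s) * B $$ (s, i))"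
      unfolding CB[symmetric] using C ri by (intro mult_mat_nth) auto
    with ri show "a r i = (\<Sum>s<p. C $$ (r, s) * b s i)" by (simp add: A_def B_def)
  qed
qed

text \<open>Induction that splits off the last index. The Schur complement of \<open>q d d\<close>
  is again Hermitian and positive definite, and its factor is completed by one more row.\<close>

lemma Cholesky_factorization:
  fixes q :: "nat \<Rightarrow> nat \<Rightarrow> complex"
  assumes "\<And>i j. i < d \<Longrightarrow> j < d \<Longrightarrow> q j i = cnj (q i j)"
    and "\<And>v. \<exists>i<d. v i \<noteq> 0 \<Longrightarrow> 0 < Re (\<Sum>i<d. \<Sum>j<d. cnj (v i) * q i j * v j)"
  shows "\<exists>r. \<forall>i<d. \<forall>j<d. q i j = (\<Sum>k<d. cnj (r k i) * r k j)"
  using assms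
proof (induction d arbitrary: q)
  case 0
  then show ?case by simp
next
  case (Suc d)
  define a where "a = Re (q d d)"
  have qdd: "q d d = of_real a"
    using Suc.prems(1)[of d d] by (simp add: a_def complex_eq_iff)
  define e where "e i = (if i = d then 1 else 0 :: complex)" for i
  have "(\<Sum>i<Suc d. \<Sum>j<Suc d. cnj (e i) * q i j * e j) =
      (\<Sum>i<Suc d. if i = d then (\<Sum>j<Suc d. if j = d then q d d else 0) else 0)"
    by (auto simp: e_def intro!: sum.cong)
  also have "\<dots> = q d d" by (simp del: sum.lessThan_Suc)
  finally have "0 < a"
    using Suc.prems(2)[of e] unfolding a_def by (auto simp: e_def)
  define q' where "q' i j = q i j - q i d * q d j / of_real a" for i j
  have "\<exists>r. \<forall>i<d. \<forall>j<d. q' i j = (\<Sum>k<d. cnj (r k i) * r k j)"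
  proof (rule Suc.IH)
    fix i j assume "i < d" "j < d"
    then show "q' j i = cnj (q' i j)"
      using Suc.prems(1)[of i j] Suc.prems(1)[of i d] Suc.prems(1)[of d j] by (simp add: q'_def)
  next
    fix v :: "nat \<Rightarrow> complex" assume v: "\<exists>i<d. v i \<noteq> 0"
    define \<beta> where "\<beta> = (\<Sum>j<d. q d j * v j)"
    define \<gamma> where "\<gamma> = (\<Sum>i<d. cnj (v i) * q i d)"
    \<comment> \<open>The last coordinate minimizes the form for fixed \<open>v\<close>; the minimum
      is the Schur complement evaluated at \<open>v\<close>.\<close>
    define w where "w i = (if i < d then v i else - \<beta> / of_real a)" for i
    have "(\<Sum>i<Suc d. \<Sum>j<Suc d. cnj (w i) * q i j * w j)
        = (\<Sum>i<d. (\<Sum>j<d. cnj (v i) * q i j * v j) + cnj (v i) * q i d * w d)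
          + ((\<Sum>j<d. cnj (w d) * q d j * v j) + cnj (w d) * q d d * w d)"
      by (simp add: w_def)
    also have "\<dots> = (\<Sum>i<d. \<Sum>j<d. cnj (v i) * q i j * v j) + \<gamma> * w d
        + (cnj (w d) * \<beta> + cnj (w d) * q d d * w d)"
      unfolding \<gamma>_def \<beta>_def sum_distrib_left sum_distrib_right sum.distrib by (simp only: mult.assoc)
    also have "\<dots> = (\<Sum>i<d. \<Sum>j<d. cnj (v i) * q i j * v j) - \<gamma> * \<beta> / of_real a"
      using \<open>0 < a\<close> by (simp add: w_def qdd)
    also have "\<gamma> * \<beta> / of_real a = (\<Sum>i<d. \<Sum>j<d. cnj (v i) * (q i d * q d j / of_real a) * v j)"
      unfolding \<gamma>_def \<beta>_def sum_product sum_divide_distrib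
      by (intro sum.cong) (auto simp: algebra_simps)
    also have "(\<Sum>i<d. \<Sum>j<d. cnj (v i) * q i j * v j) - \<dots> = (\<Sum>i<d. \<Sum>j<d. cnj (v i) * q' i j * v j)"
      unfolding sum_subtractf[symmetric]
      by (intro sum.cong refl) (simp add: q'_def algebra_simps)
    finally have "(\<Sum>i<Suc d. \<Sum>j<Suc d. cnj (w i) * q i j * w j)
        = (\<Sum>i<d. \<Sum>j<d. cnj (v i) * q' i j * v j)" .
    moreover have "\<exists>i<Suc d. w i \<noteq> 0" using v by (auto simp: w_def intro: less_SucI)
    ultimately show "0 < Re (\<Sum>i<d. \<Sum>j<d. cnj (v i) * q' i j * v j)"
      using Suc.prems(2)[of w] by simp
  qed
  then obtain r where r: "\<And>i j. i < d \<Longrightarrow> j < d \<Longrightarrow> q' i j = (\<Sum>k<d. cnj (r k i) * r k j)" by blast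
  \<comment> \<open>The factor of the Schur complement is padded with a zero column; the new last
    row contributes exactly the subtracted term \<open>q i d * q d j / a\<close>.\<close>
  define t where "t k i = (if k < d then (if i < d then r k i else 0) else q d i / of_real (sqrt a))" for k i
  have sq: "complex_of_real (sqrt a) * of_real (sqrt a) = of_real a"
    using \<open>0 < a\<close> by (simp flip: of_real_mult)
  have "q i j = (\<Sum>k<Suc d. cnj (t k i) * t k j)" if ij: "i < Suc d" "j < Suc d" for i j
  proof -
    have "cnj (q d i) = q i d" using Suc.prems(1)[of d i] ij by simp
    then have "(\<Sum>k<Suc d. cnj (t k i) * t k j)
        = (\<Sum>k<d. cnj (t k i) * t k j) + q i d * q d j / of_real a"
      by (simp add: t_def sq)
    also have "(\<Sum>k<d. cnj (t k i) * t k j) = (if i < d \<and> j < d then q' i j else 0)"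
      using r by (auto simp: t_def)
    also have "(if i < d \<and> j < d then q' i j else 0) + q i d * q d j / of_real a = q i j"
      using ij \<open>0 < a\<close> by (auto simp: q'_def less_Suc_eq qdd)
    finally show ?thesis by simp
  qed
  then show ?case by blast
qed

text \<open>The invertible \<open>R\<close> carries the inner product given by \<open>q\<close> to
  the standard one, so conjugation by \<open>R\<close> turns contractions for \<open>q\<close> into
  contractions for \<open>op_norm\<close>.\<close>

lemma posdef_gram_factorization:
  fixes q :: "nat \<Rightarrow> nat \<Rightarrow> complex"
  assumes herm: "\<And>i j. i < d \<Longrightarrow> j < d \<Longrightarrow> q j i = cnj (q i j)"
    and pos: "\<And>v. \<exists>i<d. v i \<noteq> 0 \<Longrightarrow> 0 < Re (\<Sum>i<d. \<Sum>j<d. cnj (v i) * q i j * v j)"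
  obtains R R' where "R \<in> carrier_mat d d" "R' \<in> carrier_mat d d" "R * R' = 1\<^sub>m d" "R' * R = 1\<^sub>m d"
    "\<And>v. v \<in> carrier_vec d \<Longrightarrow>
      (cvec_norm (R *\<^sub>v v))\<^sup>2 = Re (\<Sum>i<d. \<Sum>j<d. cnj (v $ i) * q i j * v $ j)"
proof -
  obtain r where r: "\<And>i j. i < d \<Longrightarrow> j < d \<Longrightarrow> q i j = (\<Sum>k<d. cnj (r k i) * r k j)"
    using Cholesky_factorization[OF assms] by blast
  define R where "R = mat d d (\<lambda>(k, i). r k i)"
  have R: "R \<in> carrier_mat d d" by (simp add: R_def)
  have norm: "(cvec_norm (R *\<^sub>v v))\<^sup>2 = Re (\<Sum>i<d. \<Sum>j<d. cnj (v $ i) * q i j * v $ j)"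
    if v: "v \<in> carrier_vec d" for v
  proof -
    have "complex_of_real ((cvec_norm (R *\<^sub>v v))\<^sup>2) = (\<Sum>k<d. cnj ((R *\<^sub>v v) $ k) * (R *\<^sub>v v) $ k)"
      using sum_cnj_mult_self[of "R *\<^sub>v v" d] R by simp
    also have "\<dots> = (\<Sum>k<d. cnj (\<Sum>i<d. r k i * v $ i) * (\<Sum>j<d. r k j * v $ j))"
      using v by (intro sum.cong) (auto simp: R_def mult_mat_vec_nth simp del: index_mult_mat_vec)
    also have "\<dots> = (\<Sum>k<d. \<Sum>i<d. \<Sum>j<d. cnj (v $ i) * (cnj (r k i) * r k j) * v $ j)"
      by (simp only: cnj_sum sum_product complex_cnj_mult) (simp only: mult_ac)
    also have "\<dots> = (\<Sum>i<d. \<Sum>k<d. \<Sum>j<d. cnj (v $ i) * (cnj (r k i) * r k j) * v $ j)"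
      by (rule sum.swap)
    also have "\<dots> = (\<Sum>i<d. \<Sum>j<d. \<Sum>k<d. cnj (v $ i) * (cnj (r k i) * r k j) * v $ j)"
      by (intro sum.cong refl sum.swap)
    also have "\<dots> = (\<Sum>i<d. \<Sum>j<d. cnj (v $ i) * q i j * v $ j)"
      by (simp add: r sum_distrib_left sum_distrib_right)
    finally have "Re (complex_of_real ((cvec_norm (R *\<^sub>v v))\<^sup>2)) = Re (\<Sum>i<d. \<Sum>j<d. cnj (v $ i) * q i j * v $ j)"
      by (rule arg_cong)
    then show ?thesis by (simp only: Re_complex_of_real)
  qed
  obtain R' where "R' \<in> carrier_mat d d" "R * R' = 1\<^sub>m d" "R' * R = 1\<^sub>m d"
  proof (rule injective_mat_inverse[OF R])
    fix v assume v: "v \<in> carrier_vec d" and "R *\<^sub>v v = 0\<^sub>v d"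
    then have "Re (\<Sum>i<d. \<Sum>j<d. cnj (v $ i) * q i j * v $ j) = 0"
      using norm[OF v] by simp
    with pos[of "\<lambda>i. v $ i"] have "\<forall>i<d. v $ i = 0" by force
    with v show "v = 0\<^sub>v d" by auto
  qed (use that in auto)
  with R norm that show thesis by blast
qed

section \<open>Operator algebras of functions and quotient norms\<close>

lemma sum_fun_apply: "(\<Sum>i\<in>I. f i) x = (\<Sum>i\<in>I. f i x)"
  for f :: "'i \<Rightarrow> 'x \<Rightarrow> 'b::comm_monoid_add"
  by (induction I rule: infinite_finite_induct) simp_all

lemma sum_lessThan_add: "(\<Sum>k<a+b. f k) = (\<Sum>k<a. f k) + (\<Sum>k<b. f (a + k))"
  for f :: "nat \<Rightarrow> 'a::comm_monoid_add"
  by (induction b) (simp_all add: add.assoc)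

lemma matrices_over_iff:
  "G \<in> matrices_over n B \<longleftrightarrow> G \<in> carrier_mat n n \<and> (\<forall>i<n. \<forall>j<n. G $$ (i, j) \<in> B)"
  unfolding matrices_over_def by (fastforce simp: elements_mat_def)

lemma op_norm_one: "op_norm (1\<^sub>m n) \<le> 1"
  by (rule op_norm_leI) auto

section \<open>Consequences of the BRS axioms\<close>

context operator_algebra
begin

text \<open>The axioms normalize only the 1 x 1 unit; larger identities are direct sums of
  it.\<close>

lemma nrm_one_mat: "0 < n \<Longrightarrow> nrm (1\<^sub>m n) = 1"
proof (induction n rule: nat_induct_non_zero)
  case (Suc n)
  have one: "1\<^sub>m k \<in> matrices_over k B" for k
    using one_closed subspace_0[OF subspace_carrier] by (auto simp: matrices_over_iff)
  have "1\<^sub>m (Suc n) = direct_sum_mat (1\<^sub>m n) (1\<^sub>m 1 :: 'a mat)"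
    by (auto simp: direct_sum_mat_def four_block_mat_def)
  with Suc nrm_direct_sum[OF _ _ one one, of n 1] nrm_one show ?case by simp
qed (use nrm_one in simp)

lemma mult_mat_closed:
  "G \<in> matrices_over n B \<Longrightarrow> H \<in> matrices_over n B \<Longrightarrow> G * H \<in> matrices_over n B"
  by (auto simp: matrices_over_iff scalar_prod_def
      intro!: subspace_sum[OF subspace_carrier] mult_closed)

lemma sandwich_closed:
  assumes "L \<in> carrier_mat m n" "G \<in> matrices_over n B" "M \<in> carrier_mat n m"
  shows "scalar_sandwich scale L G M \<in> matrices_over m B"
  using assms
  by (auto simp: matrices_over_iff scalar_sandwich_def
      intro!: subspace_sum[OF subspace_carrier] subspace_scale[OF subspace_carrier])

lemma nrm_power: "b \<in> B \<Longrightarrow> nrm (mat 1 1 (\<lambda>_. b ^ k)) \<le> nrm (mat 1 1 (\<lambda>_. b)) ^ k"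
proof (induction k)
  case 0
  have "mat 1 1 (\<lambda>_. 1) = (1\<^sub>m 1 :: 'a mat)" by auto
  then show ?case using nrm_one by simp
next
  case (Suc k)
  have mem: "mat 1 1 (\<lambda>_. b ^ j) \<in> matrices_over 1 B" for j
    using Suc.prems one_closed by (induction j) (auto simp: matrices_over_iff mult_closed)
  have "mat 1 1 (\<lambda>_. b ^ Suc k) = mat 1 1 (\<lambda>_. b) * mat 1 1 (\<lambda>_. b ^ k)"
    by (auto simp: scalar_prod_def)
  also have "nrm \<dots> \<le> nrm (mat 1 1 (\<lambda>_. b)) * nrm (mat 1 1 (\<lambda>_. b ^ k))"
    using nrm_mult[OF _ mem[of 1] mem[of k]] by simp
  also have "\<dots> \<le> nrm (mat 1 1 (\<lambda>_. b)) * nrm (mat 1 1 (\<lambda>_. b)) ^ k"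
    using Suc nrm_nonneg[OF _ mem[of 1]] by (intro mult_left_mono) auto
  finally show ?case by simp
qed

end

lemma cvec_norm_dim_1: "dim_vec v = 1 \<Longrightarrow> cvec_norm v = cmod (v $ 0)"
  by (simp add: cvec_norm_def L2_set_def)

lemma op_norm_row_le:
  assumes "dim_vec z = m"
  shows "op_norm (mat 1 m (\<lambda>(_, r). cnj (z $ r))) \<le> cvec_norm z"
proof (rule op_norm_leI)
  fix v :: "complex vec" assume "v \<in> carrier_vec (dim_col (mat 1 m (\<lambda>(_, r). cnj (z $ r))))"
  then show "cvec_norm (mat 1 m (\<lambda>(_, r). cnj (z $ r)) *\<^sub>v v) \<le> cvec_norm z * cvec_norm v"
    using cmod_sum_cnj_mult_le[OF assms, of v] by (simp add: cvec_norm_dim_1 mult_mat_vec_nth del: index_mult_mat_vec)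
qed (rule cvec_norm_nonneg)

lemma op_norm_col_le: "op_norm (mat m 1 (\<lambda>(l, _). w l)) \<le> cvec_norm (vec m w)"
proof (rule op_norm_leI)
  fix v :: "complex vec" assume "v \<in> carrier_vec (dim_col (mat m 1 (\<lambda>(l, _). w l)))"
  then have v: "dim_vec v = 1" by simp
  then have "mat m 1 (\<lambda>(l, _). w l) *\<^sub>v v = v $ 0 \<cdot>\<^sub>v vec m w"
    by (auto simp: mult_mat_vec_nth simp del: index_mult_mat_vec)
  with v show "cvec_norm (mat m 1 (\<lambda>(l, _). w l) *\<^sub>v v) \<le> cvec_norm (vec m w) * cvec_norm v"
    by (simp add: cvec_norm_smult cvec_norm_dim_1)
qed (rule cvec_norm_nonneg)

text \<open>If \<open>c\<close> exceeded a positive \<nu>, the powers of \<open>c / \<nu>\<close>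
  would be unbounded, although \<open>K\<close> bounds them. The case \<open>\<nu> = 0\<close> is
  settled by the first power.\<close>

lemma le_if_powers_le:
  fixes c \<nu> K :: real
  assumes "0 \<le> \<nu>" and le: "\<And>k. c ^ k \<le> K * \<nu> ^ k"
  shows "c \<le> \<nu>"
proof (rule ccontr)
  assume "\<not> c \<le> \<nu>"
  then have "\<nu> < c" by simp
  show False
  proof (cases "\<nu> = 0")
    case True
    with le[of 1] \<open>\<nu> < c\<close> show False by simp
  next
    case False
    with assms(1) have "0 < \<nu>" by simp
    with \<open>\<nu> < c\<close> obtain k where k: "K < (c / \<nu>) ^ k"
      using real_arch_pow[of "c / \<nu>" K] by auto
    have "(c / \<nu>) ^ k \<le> K" using le[of k] \<open>0 < \<nu>\<close> by (simp add: power_divide field_simps)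
    with k show False by simp
  qed
qed

section \<open>Evaluations, interpolation and cosets\<close>

context function_operator_algebra
begin

lemma zero_in: "0 \<in> A"
  and add_in: "f \<in> A \<Longrightarrow> g \<in> A \<Longrightarrow> f + g \<in> A"
  and diff_in: "f \<in> A \<Longrightarrow> g \<in> A \<Longrightarrow> f - g \<in> A"
  and scale_in: "f \<in> A \<Longrightarrow> fun_scale c f \<in> A"
  and sum_in: "(\<And>i. i \<in> I \<Longrightarrow> h i \<in> A) \<Longrightarrow> (\<Sum>i\<in>I. h i) \<in> A"
  using subspace_carrier subspace_0 subspace_add subspace_diff subspace_scale subspace_sum
  by metis+

text \<open>Evaluation is multiplicative, so its bound \<open>K\<close>, applied to the powers of
  \<open>f\<close>, compares \<open>|f x|^k\<close> with \<open>K\<close> times the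
  \<open>k\<close>-th power of the norm; letting \<open>k\<close> grow removes
  \<open>K\<close>.\<close>

lemma eval_le_nrm:
  assumes f: "f \<in> A"
  shows "cmod (f x) \<le> nrm (mat 1 1 (\<lambda>_. f))"
proof -
  obtain K where K: "\<And>f. f \<in> A \<Longrightarrow> cmod (f x) \<le> K * nrm (mat 1 1 (\<lambda>_. f))"
    using evaluation_bounded by blast
  have mem: "mat 1 1 (\<lambda>_. g) \<in> matrices_over 1 A" if "g \<in> A" for g
    using that by (auto simp: matrices_over_iff)
  have pow: "f ^ k \<in> A" for k
    using f one_closed by (induction k) (auto intro: mult_closed)
  have powx: "(f ^ k) x = f x ^ k" for k
    by (induction k) simp_all
  have "cmod (1 x :: complex) \<le> K * nrm (mat 1 1 (\<lambda>_. 1))" using K[OF one_closed] .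
  moreover have "0 \<le> nrm (mat 1 1 (\<lambda>_. 1))" using nrm_nonneg[OF _ mem[OF one_closed]] by simp
  ultimately have "0 \<le> K" by (smt (verit) mult_nonneg_nonpos2 norm_one one_fun_apply mult_nonpos_nonneg)
  show ?thesis
  proof (rule le_if_powers_le)
    fix k
    have "cmod (f x) ^ k \<le> K * nrm (mat 1 1 (\<lambda>_. f ^ k))"
      using K[OF pow, of k] by (simp add: powx norm_power)
    also have "\<dots> \<le> K * nrm (mat 1 1 (\<lambda>_. f)) ^ k"
      using nrm_power[OF f] \<open>0 \<le> K\<close> by (rule mult_left_mono)
    finally show "cmod (f x) ^ k \<le> K * nrm (mat 1 1 (\<lambda>_. f)) ^ k" .
  qed (use nrm_nonneg[OF _ mem[OF f]] in simp)
qed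

lemma sandwich_apply:
  assumes "L \<in> carrier_mat m n" "G \<in> carrier_mat n n" "M \<in> carrier_mat n p" "i < m" "j < p"
  shows "(scalar_sandwich fun_scale L G M $$ (i, j)) x
    = (\<Sum>k<n. \<Sum>l<n. L $$ (i, k) * M $$ (l, j) * (G $$ (k, l)) x)"
  using assms by (auto simp: scalar_sandwich_def sum_fun_apply fun_scale_def)

text \<open>Characters are automatically completely contractive: test \<open>G(x)\<close> against unit vectors.\<close>

lemma eval_mat_contractive:
  assumes "0 < m" and G: "G \<in> matrices_over m A"
  shows "(\<Sum>r<m. (cmod (\<Sum>l<m. (G $$ (r, l)) x * w l))\<^sup>2) \<le> (nrm G)\<^sup>2 * (\<Sum>l<m. (cmod (w l))\<^sup>2)"
proof -
  \<comment> \<open>\<open>z\<close> is \<open>G(x) w\<close>. Compressing \<open>G\<close> by the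
    row adjoint to \<open>z\<close> and the column \<open>w\<close> leaves a single function whose
    value at \<open>x\<close> is \<open>|z|^2\<close>, and to this function the scalar bound
    applies.\<close>
  define z where "z = vec m (\<lambda>r. \<Sum>l<m. (G $$ (r, l)) x * w l)"
  define L where "L = mat 1 m (\<lambda>(_, r). cnj (z $ r))"
  define M where "M = mat m 1 (\<lambda>(l, _). w l)"
  define S where "S = scalar_sandwich fun_scale L G M"
  have LM: "L \<in> carrier_mat 1 m" "M \<in> carrier_mat m 1" by (auto simp: L_def M_def)
  have S: "S \<in> matrices_over 1 A" unfolding S_def by (rule sandwich_closed[OF LM(1) G LM(2)])
  have "(S $$ (0, 0)) x = (\<Sum>r<m. \<Sum>l<m. cnj (z $ r) * w l * (G $$ (r, l)) x)"
    unfolding S_def using LM G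
    by (subst sandwich_apply[of _ 1 m _ _ 1]) (auto simp: L_def M_def matrices_over_iff)
  also have "\<dots> = (\<Sum>r<m. cnj (z $ r) * (\<Sum>l<m. (G $$ (r, l)) x * w l))"
    by (simp only: sum_distrib_left mult_ac)
  also have "\<dots> = (\<Sum>r<m. cnj (z $ r) * z $ r)"
    by (simp add: z_def)
  also have "\<dots> = complex_of_real ((cvec_norm z)\<^sup>2)"
    by (rule sum_cnj_mult_self) (simp add: z_def)
  finally have "(cvec_norm z)\<^sup>2 = cmod ((S $$ (0, 0)) x)"
    by (metis abs_power2 norm_of_real)
  also have "\<dots> \<le> nrm (mat 1 1 (\<lambda>_. S $$ (0, 0)))"
    using S by (intro eval_le_nrm) (auto simp: matrices_over_iff)
  also have "mat 1 1 (\<lambda>_. S $$ (0, 0)) = S"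
    using S by (auto simp: matrices_over_iff)
  also have "nrm S \<le> op_norm L * nrm G * op_norm M"
    unfolding S_def by (rule nrm_sandwich[OF _ \<open>0 < m\<close> LM(1) G LM(2)]) simp
  also have "\<dots> \<le> cvec_norm z * nrm G * cvec_norm (vec m w)"
    unfolding L_def M_def
    by (intro mult_mono op_norm_row_le op_norm_col_le mult_nonneg_nonneg op_norm_nonneg
        cvec_norm_nonneg nrm_nonneg[OF \<open>0 < m\<close> G]) (auto simp: z_def)
  finally have "cvec_norm z \<le> nrm G * cvec_norm (vec m w)"
    using cvec_norm_nonneg[of z] cvec_norm_nonneg[of "vec m w"] nrm_nonneg[OF \<open>0 < m\<close> G]
    by (cases "cvec_norm z = 0") (auto simp: power2_eq_square mult.assoc)
  then have "(cvec_norm z)\<^sup>2 \<le> (nrm G * cvec_norm (vec m w))\<^sup>2"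
    by (intro power_mono cvec_norm_nonneg)
  then show ?thesis
    by (simp add: power_mult_distrib cvec_norm_power2 z_def)
qed

text \<open>Separation and constants give a function equal to 1 at \<open>x\<close> and 0 at
  \<open>y\<close>; products of such functions over the other points of \<open>F\<close> form the
  Lagrange basis \<delta>.\<close>

lemma interpolation:
  assumes "finite F"
  obtains f where "f \<in> A" "\<And>x. x \<in> F \<Longrightarrow> f x = g x"
proof -
  have sep: "\<exists>f\<in>A. f x = 1 \<and> (\<forall>y\<in>E. f y = 0)" if "finite E" "x \<notin> E" for x E
    using that
  proof (induction E rule: finite_induct)
    case empty
    show ?case using one_closed by (intro bexI[of _ 1]) auto
  next
    case (insert y E)
    then obtain f where f: "f \<in> A" "f x = 1" "\<forall>y\<in>E. f y = 0" by auto
    obtain h where h: "h \<in> A" "h x \<noteq> h y"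
      using separates_points[of x y] insert.prems by auto
    define k where "k = fun_scale (1 / (h x - h y)) (h - (\<lambda>_. h y))"
    have "k \<in> A" unfolding k_def using h constants by (intro scale_in diff_in)
    moreover have "k x = 1" "k y = 0" using h by (auto simp: k_def fun_scale_def)
    ultimately show ?case using f by (intro bexI[of _ "k * f"]) (auto intro: mult_closed)
  qed
  have "\<exists>f\<in>A. f x = 1 \<and> (\<forall>y\<in>F - {x}. f y = 0)" for x
    using assms by (intro sep) auto
  then obtain \<delta> where \<delta>: "\<And>x. \<delta> x \<in> A" "\<And>x. \<delta> x x = 1" "\<And>x y. y \<in> F - {x} \<Longrightarrow> \<delta> x y = 0"
    by metis
  show thesis
  proof (rule that[of "\<Sum>x\<in>F. fun_scale (g x) (\<delta> x)"])
    show "(\<Sum>x\<in>F. fun_scale (g x) (\<delta> x)) \<in> A" using \<delta> by (intro sum_in scale_in)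
    fix y assume y: "y \<in> F"
    have "(\<Sum>x\<in>F. fun_scale (g x) (\<delta> x)) y = (\<Sum>x\<in>F. if x = y then g y else 0)"
      unfolding sum_fun_apply using \<delta> y by (intro sum.cong) (auto simp: fun_scale_def)
    with assms y show "(\<Sum>x\<in>F. fun_scale (g x) (\<delta> x)) y = g y" by simp
  qed
qed

text \<open>For matrices over \<open>A\<close> this is equality of cosets modulo
  \<open>vanishing_ideal A F\<close>, so the quotient norm is the infimum of \<open>nrm K\<close>
  over all \<open>K\<close> agreeing with \<open>G\<close>.\<close>

definition agree_on :: "'x set \<Rightarrow> nat \<Rightarrow> ('x \<Rightarrow> complex) mat \<Rightarrow> ('x \<Rightarrow> complex) mat \<Rightarrow> bool" where
  "agree_on F n G H \<longleftrightarrow> (\<forall>i<n. \<forall>j<n. \<forall>x\<in>F. (G $$ (i, j)) x = (H $$ (i, j)) x)"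

lemma quotient_norm_le:
  assumes "0 < n" and G: "G \<in> matrices_over n A" and K: "K \<in> matrices_over n A"
    and "agree_on F n K G"
  shows "quotient_norm A nrm F G \<le> nrm K"
proof -
  have KG: "K = G + (K - G)" using G K by (auto simp: matrices_over_iff)
  have "quotient_norm A nrm F G \<le> nrm (G + (K - G))"
    unfolding quotient_norm_def
  proof (rule cINF_lower)
    have "0 \<le> nrm (G + H)" if "H \<in> matrices_over (dim_row G) (vanishing_ideal A F)" for H
      using that G
      by (intro nrm_nonneg[OF \<open>0 < n\<close>])
        (auto simp: matrices_over_iff vanishing_ideal_def intro!: add_in)
    then show "bdd_below ((\<lambda>H. nrm (G + H)) ` matrices_over (dim_row G) (vanishing_ideal A F))"
      by (auto simp: bdd_below_def)
    show "K - G \<in> matrices_over (dim_row G) (vanishing_ideal A F)"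
      using G K assms(4)
      by (auto simp: matrices_over_iff vanishing_ideal_def agree_on_def intro!: diff_in)
  qed
  with KG show ?thesis by simp
qed

lemma le_quotient_normI:
  assumes G: "G \<in> matrices_over n A"
    and le: "\<And>K. K \<in> matrices_over n A \<Longrightarrow> agree_on F n K G \<Longrightarrow> c \<le> nrm K"
  shows "c \<le> quotient_norm A nrm F G"
  unfolding quotient_norm_def
proof (rule cINF_greatest)
  have "0\<^sub>m n n \<in> matrices_over (dim_row G) (vanishing_ideal A F)"
    using G zero_in by (auto simp: matrices_over_iff vanishing_ideal_def)
  then show "matrices_over (dim_row G) (vanishing_ideal A F) \<noteq> {}" by blast
  fix H assume "H \<in> matrices_over (dim_row G) (vanishing_ideal A F)"
  with G show "c \<le> nrm (G + H)"
    by (intro le) (auto simp: matrices_over_iff vanishing_ideal_def agree_on_def intro!: add_in)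
qed

text \<open>If \<open>K\<close> represents the coset of \<open>X\<close>, then \<open>C Y K\<close>
  represents that of \<open>X'\<close>, and its norm is at most \<open>nrm K\<close>.\<close>

lemma quotient_norm_contract:
  assumes "0 < n"
    and X: "X \<in> matrices_over n A" and X': "X' \<in> matrices_over n A" and Y: "Y \<in> matrices_over n A"
    and nrmY: "nrm Y \<le> 1" and C: "C \<in> carrier_mat n n" and opC: "op_norm C \<le> 1"
    and eq: "\<And>r c x. r < n \<Longrightarrow> c < n \<Longrightarrow> x \<in> F \<Longrightarrow>
      (X' $$ (r, c)) x = (\<Sum>s<n. C $$ (r, s) * (\<Sum>t<n. (Y $$ (s, t)) x * (X $$ (t, c)) x))"
  shows "quotient_norm A nrm F X' \<le> quotient_norm A nrm F X"
proof (rule le_quotient_normI[OF X])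
  fix K assume K: "K \<in> matrices_over n A" and agree: "agree_on F n K X"
  \<comment> \<open>The sandwich with the identity on the right is left multiplication by the scalar
    matrix \<open>C\<close>.\<close>
  define S where "S = scalar_sandwich fun_scale C (Y * K) (1\<^sub>m n)"
  have YK: "Y * K \<in> matrices_over n A" by (rule mult_mat_closed[OF Y K])
  have S: "S \<in> matrices_over n A" unfolding S_def by (rule sandwich_closed[OF C YK]) simp
  have "quotient_norm A nrm F X' \<le> nrm S"
  proof (rule quotient_norm_le[OF \<open>0 < n\<close> X' S], unfold agree_on_def, intro allI impI ballI)
    fix r c x assume rcx: "r < n" "c < n" "x \<in> F"
    have YKx: "((Y * K) $$ (k, l)) x = (\<Sum>t<n. (Y $$ (k, t)) x * (K $$ (t, l)) x)"
      if "k < n" "l < n" for k l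
      using that Y K by (subst mult_mat_nth[of _ n n _ n]) (auto simp: matrices_over_iff sum_fun_apply)
    have "(S $$ (r, c)) x = (\<Sum>k<n. \<Sum>l<n. C $$ (r, k) * 1\<^sub>m n $$ (l, c) * ((Y * K) $$ (k, l)) x)"
      unfolding S_def using rcx C YK
      by (intro sandwich_apply) (auto simp: matrices_over_iff)
    also have "\<dots> = (\<Sum>k<n. \<Sum>l<n. if l = c then C $$ (r, k) * ((Y * K) $$ (k, l)) x else 0)"
      using rcx by (intro sum.cong) auto
    also have "\<dots> = (\<Sum>k<n. C $$ (r, k) * ((Y * K) $$ (k, c)) x)"
      using rcx by simp
    also have "\<dots> = (X' $$ (r, c)) x"
      unfolding eq[OF rcx] using rcx agree by (auto simp: YKx agree_on_def intro!: sum.cong)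
    finally show "(S $$ (r, c)) x = (X' $$ (r, c)) x" .
  qed
  also have "nrm S \<le> op_norm C * nrm (Y * K) * op_norm (1\<^sub>m n)"
    unfolding S_def by (rule nrm_sandwich[OF \<open>0 < n\<close> \<open>0 < n\<close> C YK]) simp
  also have "\<dots> \<le> 1 * (1 * nrm K) * 1"
  proof (intro mult_mono opC op_norm_one mult_nonneg_nonneg op_norm_nonneg)
    have "nrm (Y * K) \<le> nrm Y * nrm K" by (rule nrm_mult[OF \<open>0 < n\<close> Y K])
    also have "\<dots> \<le> 1 * nrm K" by (intro mult_right_mono nrmY nrm_nonneg[OF \<open>0 < n\<close> K])
    finally show "nrm (Y * K) \<le> 1 * nrm K" .
  qed (use nrm_nonneg[OF \<open>0 < n\<close> K] nrm_nonneg[OF \<open>0 < n\<close> YK] in auto)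
  finally show "quotient_norm A nrm F X' \<le> nrm K" by simp
qed

end

section \<open>The quotient norm bound from a negative definite form\<close>

lemma op_norm_le_sum:
  assumes "0 \<le> c"
    and "\<And>v :: complex vec. v \<in> carrier_vec (dim_col L) \<Longrightarrow>
      (\<Sum>i<dim_row L. (cmod (\<Sum>j<dim_col L. L $$ (i, j) * v $ j))\<^sup>2) \<le> c\<^sup>2 * (\<Sum>j<dim_col L. (cmod (v $ j))\<^sup>2)"
  shows "op_norm L \<le> c"
proof (rule op_norm_leI[OF assms(1)])
  fix v :: "complex vec" assume v: "v \<in> carrier_vec (dim_col L)"
  have "(cvec_norm (L *\<^sub>v v))\<^sup>2 \<le> (c * cvec_norm v)\<^sup>2"
    using assms(2)[OF v] v
    by (simp add: cvec_norm_power2 power_mult_distrib mult_mat_vec_nth del: index_mult_mat_vec)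
  then show "cvec_norm (L *\<^sub>v v) \<le> c * cvec_norm v"
    by (rule power2_le_imp_le) (simp add: assms(1) cvec_norm_nonneg)
qed

context function_operator_algebra
begin

section \<open>Stacked matrices for the iteration\<close>

context
  fixes n m :: nat and G0 G V :: "('x \<Rightarrow> complex) mat"
  assumes n: "0 < n" and m: "0 < m"
    and G0: "G0 \<in> matrices_over n A" and G: "G \<in> matrices_over m A"
    and nrmG: "nrm G \<le> 1"
    and V: "\<And>j c. j < m \<Longrightarrow> c < n \<Longrightarrow> V $$ (j, c) \<in> A"
begin

text \<open>The first \<open>n\<close> columns hold the blocks \<beta> e, \<alpha> \<open>G0\<close>
  e and \<open>V\<close> on top of each other; zero columns make the matrix square, as the norms
  require. A block with coefficient \<open>sqrt k\<close> stands for \<open>k\<close> copies, since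
  only sums of squares enter.\<close>

definition stacked :: "real \<Rightarrow> real \<Rightarrow> ('x \<Rightarrow> complex) mat" where
  "stacked \<alpha> \<beta> = mat (n + n + m) (n + n + m) (\<lambda>(r, c).
     if c < n then
       (if r < n then (if r = c then (\<lambda>_. of_real \<beta>) else 0)
        else if r < n + n then fun_scale (of_real \<alpha>) (G0 $$ (r - n, c))
        else V $$ (r - (n + n), c))
     else 0)"

lemma stacked_in: "stacked \<alpha> \<beta> \<in> matrices_over (n + n + m) A"
  using G0 V by (auto simp: matrices_over_iff stacked_def zero_in constants intro!: scale_in)

lemma stacked_nth:
  assumes "c < n"
  shows "r < n \<Longrightarrow> stacked \<alpha> \<beta> $$ (r, c) = (if c = r then (\<lambda>_. of_real \<beta>) else 0)"
    and "r < n \<Longrightarrow> stacked \<alpha> \<beta> $$ (n + r, c) = fun_scale (of_real \<alpha>) (G0 $$ (r, c))"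
    and "j < m \<Longrightarrow> stacked \<alpha> \<beta> $$ (n + n + j, c) = V $$ (j, c)"
  using assms by (auto simp: stacked_def)

lemma direct_sum_nth:
  assumes "s < n + n + m" "t < n + n + m"
  shows "direct_sum_mat (1\<^sub>m (n + n)) G $$ (s, t) =
    (if s < n + n then (if t = s then 1 else 0)
     else if t < n + n then 0 else G $$ (s - (n + n), t - (n + n)))"
  using assms G by (auto simp: direct_sum_mat_def four_block_mat_def matrices_over_iff Let_def)

lemma direct_sum_in: "direct_sum_mat (1\<^sub>m (n + n)) G \<in> matrices_over (n + n + m) A"
  using G one_closed zero_in by (auto simp: matrices_over_iff direct_sum_nth)
    (auto simp: direct_sum_mat_def)

lemma nrm_direct_sum_le: "nrm (direct_sum_mat (1\<^sub>m (n + n)) G) \<le> 1"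
proof -
  have "(1\<^sub>m (n + n) :: ('x \<Rightarrow> complex) mat) \<in> matrices_over (n + n) A"
    using one_closed zero_in by (auto simp: matrices_over_iff)
  from nrm_direct_sum[OF _ m this G] show ?thesis using n nrmG nrm_one_mat[of "n + n"] by simp
qed

lemma direct_sum_mult_stacked:
  assumes s: "s < n + n + m" and c: "c < n"
  shows "(\<Sum>t<n + n + m. (direct_sum_mat (1\<^sub>m (n + n)) G $$ (s, t)) x * (stacked \<alpha> \<beta> $$ (t, c)) x)
    = (if s < n + n then (stacked \<alpha> \<beta> $$ (s, c)) x
       else (\<Sum>l<m. (G $$ (s - (n + n), l)) x * (V $$ (l, c)) x))"
proof (cases "s < n + n")
  case True
  have "(\<Sum>t<n + n + m. (direct_sum_mat (1\<^sub>m (n + n)) G $$ (s, t)) x * (stacked \<alpha> \<beta> $$ (t, c)) x)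
      = (\<Sum>t<n + n + m. if t = s then (stacked \<alpha> \<beta> $$ (s, c)) x else 0)"
    using s True by (intro sum.cong) (auto simp: direct_sum_nth)
  with s True show ?thesis by simp
next
  case False
  have "(\<Sum>t<n + n + m. (direct_sum_mat (1\<^sub>m (n + n)) G $$ (s, t)) x * (stacked \<alpha> \<beta> $$ (t, c)) x)
      = (\<Sum>t<n + n. 0) + (\<Sum>l<m. (G $$ (s - (n + n), l)) x * (V $$ (l, c)) x)"
    unfolding sum_lessThan_add[of _ "n + n" m] using s c False
    by (intro arg_cong2[of _ _ _ _ "(+)"] sum.cong refl) (auto simp: direct_sum_nth stacked_def)
  with False show ?thesis by simp
qed

text \<open>Scalar compression: \<open>L\<close> selects the middle block and divides by \<alpha>,
  \<open>M\<close> selects the first \<open>n\<close> columns. Every representative of the stacked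
  coset is thus sent to one of \<open>G0\<close>.\<close>

lemma quotient_norm_le_stacked:
  assumes "0 < \<alpha>"
  shows "quotient_norm A nrm F G0 \<le> (1 / \<alpha>) * quotient_norm A nrm F (stacked \<alpha> 0)"
proof -
  let ?Q = "n + n + m"
  have "\<alpha> * quotient_norm A nrm F G0 \<le> quotient_norm A nrm F (stacked \<alpha> 0)"
  proof (rule le_quotient_normI[OF stacked_in])
    fix K assume K: "K \<in> matrices_over ?Q A" and agree: "agree_on F ?Q K (stacked \<alpha> 0)"
    define L :: "complex mat" where "L = mat n ?Q (\<lambda>(i, k). if k = n + i then of_real (1 / \<alpha>) else 0)"
    define M :: "complex mat" where "M = mat ?Q n (\<lambda>(l, j). if l = j then 1 else 0)"
    define S where "S = scalar_sandwich fun_scale L K M"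
    have LM: "L \<in> carrier_mat n ?Q" "M \<in> carrier_mat ?Q n" by (auto simp: L_def M_def)
    have S: "S \<in> matrices_over n A" unfolding S_def by (rule sandwich_closed[OF LM(1) K LM(2)])
    have "op_norm L \<le> 1 / \<alpha>"
    proof (rule op_norm_le_sum)
      fix v :: "complex vec" assume "v \<in> carrier_vec (dim_col L)"
      have "(\<Sum>j<?Q. L $$ (i, j) * v $ j) = of_real (1 / \<alpha>) * v $ (n + i)" if "i < n" for i
      proof -
        have "(\<Sum>j<?Q. L $$ (i, j) * v $ j) = (\<Sum>j<?Q. if j = n + i then of_real (1 / \<alpha>) * v $ (n + i) else 0)"
          using that by (intro sum.cong) (auto simp: L_def)
        with that show ?thesis by simp
      qed
      then have "(\<Sum>i<dim_row L. (cmod (\<Sum>j<dim_col L. L $$ (i, j) * v $ j))\<^sup>2)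
          = (1 / \<alpha>)\<^sup>2 * (\<Sum>i<n. (cmod (v $ (n + i)))\<^sup>2)"
        using LM(1) by (simp add: norm_mult power_mult_distrib sum_distrib_left norm_divide power_divide)
      also have "\<dots> \<le> (1 / \<alpha>)\<^sup>2 * (\<Sum>j<?Q. (cmod (v $ j))\<^sup>2)"
        unfolding sum_lessThan_add by (intro mult_left_mono) (auto intro!: add_increasing add_increasing2 sum_nonneg)
      finally show "(\<Sum>i<dim_row L. (cmod (\<Sum>j<dim_col L. L $$ (i, j) * v $ j))\<^sup>2)
          \<le> (1 / \<alpha>)\<^sup>2 * (\<Sum>j<dim_col L. (cmod (v $ j))\<^sup>2)" using LM(1) by simp
    qed (use assms in simp)
    moreover have "op_norm M \<le> 1"
    proof (rule op_norm_le_sum)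
      fix v :: "complex vec" assume "v \<in> carrier_vec (dim_col M)"
      have "(\<Sum>j<n. M $$ (i, j) * v $ j) = (if i < n then v $ i else 0)" if "i < ?Q" for i
      proof -
        have "(\<Sum>j<n. M $$ (i, j) * v $ j) = (\<Sum>j<n. if j = i then v $ i else 0)"
          using that by (intro sum.cong) (auto simp: M_def)
        with that show ?thesis by simp
      qed
      then have "(\<Sum>i<?Q. (cmod (\<Sum>j<n. M $$ (i, j) * v $ j))\<^sup>2) = (\<Sum>i<n. (cmod (v $ i))\<^sup>2)"
        unfolding sum_lessThan_add by simp
      then show "(\<Sum>i<dim_row M. (cmod (\<Sum>j<dim_col M. M $$ (i, j) * v $ j))\<^sup>2)
          \<le> 1\<^sup>2 * (\<Sum>j<dim_col M. (cmod (v $ j))\<^sup>2)" using LM(2) by simp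
    qed simp
    moreover have "nrm S \<le> op_norm L * nrm K * op_norm M"
      unfolding S_def using n by (intro nrm_sandwich[OF n _ LM(1) K LM(2)]) simp
    moreover have "0 \<le> nrm K" using n by (intro nrm_nonneg[OF _ K]) simp
    ultimately have "nrm S \<le> 1 / \<alpha> * nrm K * 1"
      using op_norm_nonneg[of M] assms
      by (elim order_trans) (intro mult_mono mult_nonneg_nonneg, auto)
    moreover have "quotient_norm A nrm F G0 \<le> nrm S"
    proof (rule quotient_norm_le[OF n G0 S], unfold agree_on_def, intro allI impI ballI)
      fix i j x assume ij: "i < n" "j < n" and x: "x \<in> F"
      have "(S $$ (i, j)) x = (\<Sum>k<?Q. \<Sum>l<?Q. L $$ (i, k) * M $$ (l, j) * (K $$ (k, l)) x)"
        unfolding S_def using ij K LM by (intro sandwich_apply) (auto simp: matrices_over_iff)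
      also have "\<dots> = (\<Sum>k<?Q. \<Sum>l<?Q. if l = j then (if k = n + i then of_real (1 / \<alpha>) * (K $$ (k, l)) x else 0) else 0)"
        using ij by (intro sum.cong) (auto simp: L_def M_def)
      also have "\<dots> = (\<Sum>k<?Q. if k = n + i then of_real (1 / \<alpha>) * (K $$ (k, j)) x else 0)"
        using ij by simp
      also have "\<dots> = of_real (1 / \<alpha>) * (K $$ (n + i, j)) x" using ij by simp
      also have "(K $$ (n + i, j)) x = of_real \<alpha> * (G0 $$ (i, j)) x"
        using agree ij x by (simp add: agree_on_def stacked_nth fun_scale_def)
      finally show "(S $$ (i, j)) x = (G0 $$ (i, j)) x" using assms by simp
    qed
    ultimately have "quotient_norm A nrm F G0 \<le> 1 / \<alpha> * nrm K" by simp
    then show "\<alpha> * quotient_norm A nrm F G0 \<le> nrm K" using assms by (simp add: field_simps)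
  qed
  then show ?thesis using assms by (simp add: field_simps)
qed

text \<open>The block \<beta> e is \<beta> times a corner projection of norm 1; what remains
  contains only \<open>V\<close> and does not depend on \<beta>.\<close>

lemma quotient_norm_stacked_le:
  assumes "0 \<le> \<beta>"
  shows "quotient_norm A nrm F (stacked 0 \<beta>) \<le> \<beta> + nrm (stacked 0 0)"
proof -
  let ?Q = "n + n + m"
  define E :: "('x \<Rightarrow> complex) mat" where "E = direct_sum_mat (1\<^sub>m n) (0\<^sub>m (n + m) (n + m))"
  have mem: "1\<^sub>m n \<in> matrices_over n A" "0\<^sub>m (n + m) (n + m) \<in> matrices_over (n + m) A"
    using one_closed zero_in by (auto simp: matrices_over_iff)
  have "E \<in> carrier_mat ?Q ?Q" by (auto simp: E_def direct_sum_mat_def)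
  then have E: "E \<in> matrices_over ?Q A"
    using one_closed zero_in by (auto simp: matrices_over_iff E_def direct_sum_mat_def four_block_mat_def)
  have "nrm E = max (nrm (1\<^sub>m n)) (nrm (0\<^sub>m (n + m) (n + m)))"
    unfolding E_def using n mem by (intro nrm_direct_sum) auto
  also have "nrm (0\<^sub>m (n + m) (n + m)) = 0" using nrm_eq_0_iff[OF _ mem(2)] n by simp
  finally have nrmE: "nrm E = 1" using nrm_one_mat[OF n] by simp
  have scaled: "map_mat (fun_scale (of_real \<beta>)) E \<in> matrices_over ?Q A"
    using E by (auto simp: matrices_over_iff intro!: scale_in)
  have "stacked 0 \<beta> = map_mat (fun_scale (of_real \<beta>)) E + stacked 0 0"
    using \<open>E \<in> carrier_mat ?Q ?Q\<close>
    by (intro eq_matI) (auto simp: stacked_def E_def direct_sum_mat_def four_block_mat_def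
        fun_scale_def fun_eq_iff)
  then have "nrm (stacked 0 \<beta>) \<le> nrm (map_mat (fun_scale (of_real \<beta>)) E) + nrm (stacked 0 0)"
    using nrm_triangle[OF _ scaled stacked_in[of 0 0]] n by simp
  also have "nrm (map_mat (fun_scale (of_real \<beta>)) E) = \<beta>"
    using nrm_scale[OF _ E] n nrmE assms by simp
  finally have "nrm (stacked 0 \<beta>) \<le> \<beta> + nrm (stacked 0 0)" .
  moreover have "quotient_norm A nrm F (stacked 0 \<beta>) \<le> nrm (stacked 0 \<beta>)"
    using n by (intro quotient_norm_le[OF _ stacked_in stacked_in]) (auto simp: agree_on_def)
  ultimately show ?thesis by simp
qed

text \<open>\<open>strict\<close> states \<open>|V|^2 + |G0 e|^2 < |G V|^2 + |e|^2\<close> as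
  quadratic forms in \<open>y\<close>, whose coordinate \<open>i\<close> belongs to the point
  \<open>pt i\<close> and the column \<open>co i\<close>.\<close>

context
  fixes F :: "'x set" and d :: nat and pt :: "nat \<Rightarrow> 'x" and co :: "nat \<Rightarrow> nat"
  assumes bij: "bij_betw (\<lambda>i. (pt i, co i)) {..<d} (F \<times> {..<n})"
    and strict: "\<And>y. \<exists>i<d. y i \<noteq> 0 \<Longrightarrow>
      (\<Sum>j<m. (cmod (\<Sum>i<d. (V $$ (j, co i)) (pt i) * y i))\<^sup>2)
        + (\<Sum>r<n. (cmod (\<Sum>i<d. (G0 $$ (r, co i)) (pt i) * y i))\<^sup>2)
      < (\<Sum>j<m. (cmod (\<Sum>i<d. (\<Sum>l<m. (G $$ (j, l)) (pt i) * (V $$ (l, co i)) (pt i)) * y i))\<^sup>2)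
        + (\<Sum>r<n. (cmod (\<Sum>i<d. (if co i = r then 1 else 0) * y i))\<^sup>2)"
begin

text \<open>Adding \<beta>^2 \<open>|e|^2\<close> and \<alpha>^2 \<open>|G0 e|^2\<close> to both
  sides of \<open>strict\<close> keeps it strict. Douglas factorization then recovers the left stack
  on \<open>F\<close> by applying to the right stack first the direct sum of the identity and
  \<open>G\<close>, then a scalar contraction: one unit of squared weight passes from e to
  \<open>G0\<close> e.\<close>

lemma quotient_norm_stacked_step:
  assumes "0 \<le> \<alpha>" "0 \<le> \<beta>"
  shows "quotient_norm A nrm F (stacked (sqrt (\<alpha>\<^sup>2 + 1)) \<beta>)
    \<le> quotient_norm A nrm F (stacked \<alpha> (sqrt (\<beta>\<^sup>2 + 1)))"
proof -
  let ?Q = "n + n + m"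
  let ?X = "stacked \<alpha> (sqrt (\<beta>\<^sup>2 + 1))" and ?X' = "stacked (sqrt (\<alpha>\<^sup>2 + 1)) \<beta>"
  let ?Y = "direct_sum_mat (1\<^sub>m (n + n)) G"
  have co: "co i < n" and pt: "pt i \<in> F" if "i < d" for i
    using bij that by (auto simp: bij_betw_def)
  have onto: "\<exists>i<d. pt i = x \<and> co i = c" if "x \<in> F" "c < n" for x c
  proof -
    have "(x, c) \<in> (\<lambda>i. (pt i, co i)) ` {..<d}" using bij that by (auto simp: bij_betw_def)
    then show ?thesis by auto
  qed
  define a where "a r i = (?X' $$ (r, co i)) (pt i)" for r i
  define b where "b s i = (\<Sum>t<?Q. (?Y $$ (s, t)) (pt i) * (?X $$ (t, co i)) (pt i))" for s i
  obtain C where C: "C \<in> carrier_mat ?Q ?Q" "op_norm C \<le> 1"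
    and eq: "\<And>r i. r < ?Q \<Longrightarrow> i < d \<Longrightarrow> a r i = (\<Sum>s<?Q. C $$ (r, s) * b s i)"
  proof (rule strict_gram_factorization)
    fix y :: "nat \<Rightarrow> complex" assume y: "\<exists>i<d. y i \<noteq> 0"
    define e where "e = (\<Sum>r<n. (cmod (\<Sum>i<d. (if co i = r then 1 else 0) * y i))\<^sup>2)"
    define g where "g = (\<Sum>r<n. (cmod (\<Sum>i<d. (G0 $$ (r, co i)) (pt i) * y i))\<^sup>2)"
    have rows: "(\<Sum>r<n. (cmod (\<Sum>i<d. (stacked \<gamma> \<delta> $$ (r, co i)) (pt i) * y i))\<^sup>2) = \<delta>\<^sup>2 * e"
      "(\<Sum>r<n. (cmod (\<Sum>i<d. (stacked \<gamma> \<delta> $$ (n + r, co i)) (pt i) * y i))\<^sup>2) = \<gamma>\<^sup>2 * g" for \<gamma> \<delta>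
    proof -
      have "(\<Sum>i<d. (stacked \<gamma> \<delta> $$ (r, co i)) (pt i) * y i)
          = of_real \<delta> * (\<Sum>i<d. (if co i = r then 1 else 0) * y i)" if "r < n" for r
        unfolding sum_distrib_left using that co by (intro sum.cong) (auto simp: stacked_nth)
      then show "(\<Sum>r<n. (cmod (\<Sum>i<d. (stacked \<gamma> \<delta> $$ (r, co i)) (pt i) * y i))\<^sup>2) = \<delta>\<^sup>2 * e"
        by (simp add: e_def norm_mult power_mult_distrib sum_distrib_left[symmetric])
      have "(\<Sum>i<d. (stacked \<gamma> \<delta> $$ (n + r, co i)) (pt i) * y i)
          = of_real \<gamma> * (\<Sum>i<d. (G0 $$ (r, co i)) (pt i) * y i)" if "r < n" for r
        unfolding sum_distrib_left using that co
        by (intro sum.cong) (auto simp: stacked_nth fun_scale_def)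
      then show "(\<Sum>r<n. (cmod (\<Sum>i<d. (stacked \<gamma> \<delta> $$ (n + r, co i)) (pt i) * y i))\<^sup>2) = \<gamma>\<^sup>2 * g"
        by (simp add: g_def norm_mult power_mult_distrib sum_distrib_left[symmetric])
    qed
    have "(\<Sum>r<?Q. (cmod (\<Sum>i<d. a r i * y i))\<^sup>2) = \<beta>\<^sup>2 * e + (\<alpha>\<^sup>2 + 1) * g
        + (\<Sum>j<m. (cmod (\<Sum>i<d. (V $$ (j, co i)) (pt i) * y i))\<^sup>2)"
    proof -
      have "(\<Sum>j<m. (cmod (\<Sum>i<d. a (n + n + j) i * y i))\<^sup>2)
          = (\<Sum>j<m. (cmod (\<Sum>i<d. (V $$ (j, co i)) (pt i) * y i))\<^sup>2)"
        using co by (simp add: a_def stacked_nth)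
      then show ?thesis unfolding sum_lessThan_add by (simp add: a_def rows)
    qed
    also have "\<dots> < (\<beta>\<^sup>2 + 1) * e + \<alpha>\<^sup>2 * g
        + (\<Sum>j<m. (cmod (\<Sum>i<d. (\<Sum>l<m. (G $$ (j, l)) (pt i) * (V $$ (l, co i)) (pt i)) * y i))\<^sup>2)"
      using strict[OF y] by (simp add: e_def g_def algebra_simps)
    also have "\<dots> = (\<Sum>r<?Q. (cmod (\<Sum>i<d. b r i * y i))\<^sup>2)"
    proof -
      have top: "b s i = (?X $$ (s, co i)) (pt i)" if "s < n + n" "i < d" for s i
        using that co[of i] by (simp add: b_def direct_sum_mult_stacked)
      have "b (n + n + j) i = (\<Sum>l<m. (G $$ (j, l)) (pt i) * (V $$ (l, co i)) (pt i))"
        if "j < m" "i < d" for j i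
        using that co[of i] by (simp add: b_def direct_sum_mult_stacked)
      then have "(\<Sum>j<m. (cmod (\<Sum>i<d. b (n + n + j) i * y i))\<^sup>2)
          = (\<Sum>j<m. (cmod (\<Sum>i<d. (\<Sum>l<m. (G $$ (j, l)) (pt i) * (V $$ (l, co i)) (pt i)) * y i))\<^sup>2)"
        by simp
      moreover have "(\<Sum>r<n. (cmod (\<Sum>i<d. b r i * y i))\<^sup>2) = (\<beta>\<^sup>2 + 1) * e"
        "(\<Sum>r<n. (cmod (\<Sum>i<d. b (n + r) i * y i))\<^sup>2) = \<alpha>\<^sup>2 * g"
        using rows[of \<alpha> "sqrt (\<beta>\<^sup>2 + 1)"] by (simp_all add: top)
      ultimately show ?thesis unfolding sum_lessThan_add by simp
    qed
    finally show "(\<Sum>r<?Q. (cmod (\<Sum>i<d. a r i * y i))\<^sup>2) < (\<Sum>r<?Q. (cmod (\<Sum>i<d. b r i * y i))\<^sup>2)" .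
  qed (use that in blast)
  show ?thesis
  proof (rule quotient_norm_contract[OF _ stacked_in stacked_in direct_sum_in nrm_direct_sum_le C])
    fix r c x assume rc: "r < ?Q" "c < ?Q" and x: "x \<in> F"
    show "(?X' $$ (r, c)) x = (\<Sum>s<?Q. C $$ (r, s) * (\<Sum>t<?Q. (?Y $$ (s, t)) x * (?X $$ (t, c)) x))"
    \<comment> \<open>Columns below \<open>n\<close> at points of \<open>F\<close> are those
      enumerated by \<open>i < d\<close>; the remaining columns vanish on both sides.\<close>
    proof (cases "c < n")
      case True
      with onto[OF x] obtain i where "i < d" "pt i = x" "co i = c" by blast
      with eq[of r i] rc show ?thesis by (simp add: a_def b_def)
    next
      case False
      with rc show ?thesis by (simp add: stacked_def)
    qed
  qed (use n in simp)
qed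

text \<open>Iterating the contraction \<open>(e; v) \<mapsto> (G\<^sub>0 e; v)\<close> on \<open>N\<close> copies of \<open>e\<close> costs the
  tail \<open>v\<close> only once, so its contribution vanishes as \<open>N \<rightarrow> \<infinity>\<close>.\<close>

lemma quotient_norm_le_one: "quotient_norm A nrm F G0 \<le> 1"
proof (rule ccontr)
  assume "\<not> ?thesis"
  then have gt: "quotient_norm A nrm F G0 - 1 > 0" by simp
  let ?\<kappa> = "nrm (stacked 0 0)"
  have chain: "quotient_norm A nrm F (stacked (sqrt (real k)) (sqrt (real l)))
      \<le> quotient_norm A nrm F (stacked 0 (sqrt (real (k + l))))" for k l
  proof (induction k arbitrary: l)
    case (Suc k)
    have "quotient_norm A nrm F (stacked (sqrt (real (Suc k))) (sqrt (real l)))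
        \<le> quotient_norm A nrm F (stacked (sqrt (real k)) (sqrt (real (Suc l))))"
      using quotient_norm_stacked_step[of "sqrt (real k)" "sqrt (real l)"] by (simp add: add.commute)
    also have "\<dots> \<le> quotient_norm A nrm F (stacked 0 (sqrt (real (k + Suc l))))" by (rule Suc.IH)
    finally show ?case by simp
  qed simp
  \<comment> \<open>\<open>N\<close> is so large that \<open>sqrt N\<close> times the excess of the
    quotient norm over 1 is greater than \<open>?\<kappa>\<close>.\<close>
  obtain N :: nat where N: "(?\<kappa> / (quotient_norm A nrm F G0 - 1))\<^sup>2 < real N"
    using reals_Archimedean2 by blast
  then have "0 < real N" by (rule le_less_trans[OF zero_le_power2])
  with N have N: "(?\<kappa> / (quotient_norm A nrm F G0 - 1))\<^sup>2 < real N" "0 < N" by simp_all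
  then have "?\<kappa> / (quotient_norm A nrm F G0 - 1) < sqrt (real N)"
    by (simp add: real_less_rsqrt)
  then have "?\<kappa> < sqrt (real N) * (quotient_norm A nrm F G0 - 1)"
    using gt by (simp add: pos_divide_less_eq)
  moreover have "quotient_norm A nrm F G0 \<le> (1 / sqrt (real N)) * (sqrt (real N) + ?\<kappa>)"
    using quotient_norm_le_stacked[of "sqrt (real N)" F] chain[of N 0]
      quotient_norm_stacked_le[of "sqrt (real N)" F] N(2)
    by (simp add: field_simps)
  ultimately show False using N(2) by (simp add: field_simps)
qed

end

end

end

section \<open>Gram matrices of functionals on the unit sphere\<close>

definition quad :: "nat \<Rightarrow> (nat \<Rightarrow> nat \<Rightarrow> complex) \<Rightarrow> (nat \<Rightarrow> complex) \<Rightarrow> real" where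
  "quad d q v = Re (\<Sum>i<d. \<Sum>j<d. cnj (v i) * q i j * v j)"

definition unit_sphere :: "nat \<Rightarrow> (nat \<Rightarrow> complex) set" where
  "unit_sphere d = {y. (\<Sum>i<d. (cmod (y i))\<^sup>2) = 1}"

text \<open>The pairing is bilinear, without conjugation. For fixed \<open>v\<close> this is the
  quadratic form in \<open>y\<close> with the rank one matrix \<open>cnj (v i) * v j\<close>; for
  fixed \<open>y\<close> it is a form in \<open>v\<close>, so a functional in \<open>y\<close>
  produces a form in \<open>v\<close>.\<close>

definition rank_one :: "nat \<Rightarrow> (nat \<Rightarrow> complex) \<Rightarrow> (nat \<Rightarrow> complex) \<Rightarrow> real" where
  "rank_one d v y = (cmod (\<Sum>i<d. v i * y i))\<^sup>2"

lemma unit_sphere_cmod_le: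
  assumes "y \<in> unit_sphere d" "i < d"
  shows "cmod (y i) \<le> 1"
proof -
  have "(cmod (y i))\<^sup>2 \<le> (\<Sum>i<d. (cmod (y i))\<^sup>2)"
    using assms(2) by (intro member_le_sum) auto
  also have "\<dots> = 1\<^sup>2" using assms(1) by (simp add: unit_sphere_def)
  finally show ?thesis by (rule power2_le_imp_le) simp
qed

lemma unit_sphere_bounded_mult:
  assumes "i < d" "j < d"
  shows "bounded_fun (unit_sphere d) (\<lambda>y. Re (cnj (y i) * y j))"
    and "bounded_fun (unit_sphere d) (\<lambda>y. Im (cnj (y i) * y j))"
proof -
  have "cmod (cnj (y i) * y j) \<le> 1" if "y \<in> unit_sphere d" for y
    using unit_sphere_cmod_le[OF that assms(1)] unit_sphere_cmod_le[OF that assms(2)]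
    by (simp add: norm_mult mult_le_one)
  then show "bounded_fun (unit_sphere d) (\<lambda>y. Re (cnj (y i) * y j))"
    "bounded_fun (unit_sphere d) (\<lambda>y. Im (cnj (y i) * y j))"
    unfolding bounded_fun_def by (meson abs_Re_le_cmod abs_Im_le_cmod order_trans)+
qed

lemma rank_one_nonneg: "0 \<le> rank_one d v y"
  by (simp add: rank_one_def)

lemma rank_one_scale: "rank_one d (\<lambda>i. c * v i) y = (cmod c)\<^sup>2 * rank_one d v y"
  by (simp add: rank_one_def mult.assoc norm_mult power_mult_distrib flip: sum_distrib_left)

lemma rank_one_scale_right: "rank_one d v (\<lambda>i. c * y i) = (cmod c)\<^sup>2 * rank_one d v y"
  by (simp add: rank_one_def mult.left_commute[of _ c] norm_mult power_mult_distrib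
      flip: sum_distrib_left)

text \<open>Real coefficients times the functions \<open>Re (cnj (y i) * y j)\<close> and
  \<open>Im (cnj (y i) * y j)\<close>, so that a real functional applies term by term. The sign
  stays inside the coefficient to fit the rules for sums and multiples.\<close>

lemma rank_one_expand:
  "rank_one d v y = (\<Sum>i<d. \<Sum>j<d. Re (cnj (v i) * v j) * Re (cnj (y i) * y j)
    + - Im (cnj (v i) * v j) * Im (cnj (y i) * y j))"
proof -
  have "complex_of_real (rank_one d v y) = cnj (\<Sum>i<d. v i * y i) * (\<Sum>j<d. v j * y j)"
    unfolding rank_one_def complex_norm_square by (rule mult.commute)
  also have "\<dots> = (\<Sum>i<d. \<Sum>j<d. (cnj (v i) * v j) * (cnj (y i) * y j))"
    unfolding cnj_sum sum_product by (intro sum.cong refl) (simp add: mult_ac)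
  finally have "Re (complex_of_real (rank_one d v y))
      = Re (\<Sum>i<d. \<Sum>j<d. (cnj (v i) * v j) * (cnj (y i) * y j))" by (rule arg_cong)
  then show ?thesis by (simp only: Re_complex_of_real Re_sum times_complex.sel) (simp add: algebra_simps)
qed

lemma bounded_rank_one: "bounded_fun (unit_sphere d) (rank_one d v)"
  unfolding rank_one_expand
  by (intro bounded_fun_sum bounded_fun_add bounded_fun_scale unit_sphere_bounded_mult) auto

text \<open>\<open>q\<close> is the mean under \<phi> of the matrices
  \<open>cnj (y i) * y j\<close>, with real and imaginary parts taken separately because \<phi> is
  real.\<close>

lemma positive_functional_gram:
  assumes "positive_functional (unit_sphere d) \<phi>"
  obtains q where "\<forall>i<d. \<forall>j<d. q j i = cnj (q i j)" "\<forall>v. quad d q v = \<phi> (rank_one d v)"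
proof -
  interpret positive_functional "unit_sphere d" \<phi> by fact
  define q where "q i j = Complex (\<phi> (\<lambda>y. Re (cnj (y i) * y j))) (\<phi> (\<lambda>y. Im (cnj (y i) * y j)))" for i j
  show thesis
  proof (rule that; intro allI impI)
    fix i j assume "i < d" "j < d"
    have "(\<lambda>y. Re (cnj (y j) * y i)) = (\<lambda>y. Re (cnj (y i) * y j))"
      "(\<lambda>y. Im (cnj (y j) * y i)) = (\<lambda>y. -1 * Im (cnj (y i) * y j))"
      by (auto simp: fun_eq_iff)
    then show "q j i = cnj (q i j)"
      using scale[OF unit_sphere_bounded_mult(2)[OF \<open>i < d\<close> \<open>j < d\<close>], of "-1"]
      by (simp only: q_def complex_eq_iff) simp
  next
    fix v
    have "\<phi> (rank_one d v) = (\<Sum>i<d. \<phi> (\<lambda>y. \<Sum>j<d. Re (cnj (v i) * v j) * Re (cnj (y i) * y j)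
        + - Im (cnj (v i) * v j) * Im (cnj (y i) * y j)))"
      unfolding rank_one_expand[abs_def]
      by (rule sum)
        (auto intro!: bounded_fun_sum bounded_fun_add bounded_fun_scale unit_sphere_bounded_mult
          simp del: mult_minus_left times_complex.sel complex_mult_cnj)
    also have "\<dots> = (\<Sum>i<d. \<Sum>j<d. \<phi> (\<lambda>y. Re (cnj (v i) * v j) * Re (cnj (y i) * y j)
        + - Im (cnj (v i) * v j) * Im (cnj (y i) * y j)))"
      by (intro sum.cong refl sum)
        (auto intro!: bounded_fun_add bounded_fun_scale unit_sphere_bounded_mult
          simp del: mult_minus_left times_complex.sel complex_mult_cnj)
    also have "\<dots> = (\<Sum>i<d. \<Sum>j<d. Re (cnj (v i) * v j) * Re (q i j) + - Im (cnj (v i) * v j) * Im (q i j))"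
    proof (intro sum.cong refl)
      fix i j assume "i \<in> {..<d}" "j \<in> {..<d}"
      then have ij: "i < d" "j < d" by auto
      note b = unit_sphere_bounded_mult[OF ij]
      show "\<phi> (\<lambda>y. Re (cnj (v i) * v j) * Re (cnj (y i) * y j)
          + - Im (cnj (v i) * v j) * Im (cnj (y i) * y j))
        = Re (cnj (v i) * v j) * Re (q i j) + - Im (cnj (v i) * v j) * Im (q i j)"
        unfolding add[OF bounded_fun_scale[OF b(1)] bounded_fun_scale[OF b(2)]]
          scale[OF b(1)] scale[OF b(2)] q_def by simp
    qed
    also have "\<dots> = quad d q v"
      unfolding quad_def Re_sum by (intro sum.cong refl) (simp add: algebra_simps)
    finally show "quad d q v = \<phi> (rank_one d v)" by simp
  qed
qed

section \<open>The separating form\<close>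

lemma quad_cong: "(\<And>i. i < d \<Longrightarrow> v i = w i) \<Longrightarrow> quad d q v = quad d q w"
  by (simp add: quad_def)

context function_operator_algebra
begin

text \<open>\<open>i < d\<close> enumerates the coordinates \<open>(pt i, co i)\<close> of \<open>\<complex>\<^sup>F \<otimes> \<complex>\<^sup>n\<close>.\<close>

context
  fixes F :: "'x set" and n d :: nat and pt :: "nat \<Rightarrow> 'x" and co :: "nat \<Rightarrow> nat"
    and G0 :: "('x \<Rightarrow> complex) mat"
  assumes n: "0 < n" and F: "finite F" and G0: "G0 \<in> matrices_over n A"
    and bij: "bij_betw (\<lambda>i. (pt i, co i)) {..<d} (F \<times> {..<n})"
    and gt: "1 < quotient_norm A nrm F G0"
begin

definition act :: "nat \<Rightarrow> ('x \<Rightarrow> complex) mat \<Rightarrow> (nat \<Rightarrow> nat \<Rightarrow> complex) \<Rightarrow> nat \<Rightarrow> nat \<Rightarrow> complex" where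
  "act m G v r i = (\<Sum>l<m. (G $$ (r, l)) (pt i) * v l i)"

definition e_vec :: "nat \<Rightarrow> nat \<Rightarrow> complex" where
  "e_vec r i = (if co i = r then 1 else 0)"

text \<open>On indices below \<open>d\<close> this is \<open>act n G0 e_vec r\<close>, with the sum
  already evaluated.\<close>

definition row0 :: "nat \<Rightarrow> nat \<Rightarrow> complex" where
  "row0 r i = (G0 $$ (r, co i)) (pt i)"

definition defect :: "nat \<Rightarrow> ('x \<Rightarrow> complex) mat \<Rightarrow> (nat \<Rightarrow> nat \<Rightarrow> complex) \<Rightarrow> (nat \<Rightarrow> complex) \<Rightarrow> real" where
  "defect m G v y = (\<Sum>j<m. rank_one d (v j) y) - (\<Sum>r<m. rank_one d (act m G v r) y)"

definition excess :: "(nat \<Rightarrow> complex) \<Rightarrow> real" where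
  "excess y = (\<Sum>r<n. rank_one d (row0 r) y) - (\<Sum>r<n. rank_one d (e_vec r) y)"

text \<open>Strict positivity of \<tau> allows it to be normalized to 1 in
  \<open>gram_cone_not_negative\<close>; the limit \<tau> -> 0 is taken in
  \<open>separating_gram\<close>.\<close>

definition gram_cone :: "((nat \<Rightarrow> complex) \<Rightarrow> real) set" where
  "gram_cone = {f. \<exists>m G v \<tau>. 0 < m \<and> G \<in> matrices_over m A \<and> nrm G \<le> 1 \<and> 0 < \<tau> \<and>
     f = (\<lambda>y. defect m G v y + \<tau> * excess y)}"

lemma gram_coneI:
  "0 < m \<Longrightarrow> G \<in> matrices_over m A \<Longrightarrow> nrm G \<le> 1 \<Longrightarrow> 0 < \<tau> \<Longrightarrow>
    (\<And>y. f y = defect m G v y + \<tau> * excess y) \<Longrightarrow> f \<in> gram_cone"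
  unfolding gram_cone_def by blast

lemma defect_scale:
  "defect m G (\<lambda>j i. c * v j i) y = (cmod c)\<^sup>2 * defect m G v y"
proof -
  have "act m G (\<lambda>j i. c * v j i) r = (\<lambda>i. c * act m G v r i)" for r
    by (auto simp: act_def sum_distrib_left mult_ac)
  then show ?thesis
    by (simp add: defect_def rank_one_scale sum_distrib_left right_diff_distrib)
qed

lemma defect_scale_right: "defect m G v (\<lambda>i. c * y i) = (cmod c)\<^sup>2 * defect m G v y"
  by (simp add: defect_def rank_one_scale_right sum_distrib_left right_diff_distrib)

lemma excess_scale_right: "excess (\<lambda>i. c * y i) = (cmod c)\<^sup>2 * excess y"
  by (simp add: excess_def rank_one_scale_right sum_distrib_left right_diff_distrib)

lemma defect_direct_sum:
  assumes G: "G \<in> matrices_over m A" and H: "H \<in> matrices_over k A"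
  shows "defect (m + k) (direct_sum_mat G H) (\<lambda>j. if j < m then v j else w (j - m)) y
    = defect m G v y + defect k H w y"
proof -
  let ?u = "\<lambda>j. if j < m then v j else w (j - m)"
  have "act (m + k) (direct_sum_mat G H) ?u r = act m G v r" if "r < m" for r
    using that G H unfolding act_def sum_lessThan_add fun_eq_iff
    by (auto simp: direct_sum_mat_def matrices_over_iff)
  moreover have "act (m + k) (direct_sum_mat G H) ?u (m + r) = act k H w r" if "r < k" for r
    using that G H unfolding act_def sum_lessThan_add fun_eq_iff
    by (auto simp: direct_sum_mat_def matrices_over_iff)
  ultimately show ?thesis by (simp add: defect_def sum_lessThan_add)
qed

text \<open>Sums are absorbed by direct sums, whose norm is the maximum and so stays at most 1; a
  factor \<open>a\<close> is absorbed by \<open>sqrt a\<close> in \<open>v\<close> and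
  \<open>a\<close> in \<tau>.\<close>

lemma gram_cone_cone: "fun_cone gram_cone"
  unfolding fun_cone_def
proof (intro conjI ballI allI impI)
  fix f g assume "f \<in> gram_cone" "g \<in> gram_cone"
  then obtain m G v \<tau> k H w \<sigma> where f: "0 < m" "G \<in> matrices_over m A" "nrm G \<le> 1" "0 < \<tau>"
      "f = (\<lambda>y. defect m G v y + \<tau> * excess y)"
    and g: "0 < k" "H \<in> matrices_over k A" "nrm H \<le> 1" "0 < \<sigma>"
      "g = (\<lambda>y. defect k H w y + \<sigma> * excess y)"
    unfolding gram_cone_def by blast
  show "(\<lambda>y. f y + g y) \<in> gram_cone"
  proof (rule gram_coneI)
    show "direct_sum_mat G H \<in> matrices_over (m + k) A"
      using f(2) g(2) zero_in by (auto simp: matrices_over_iff direct_sum_mat_def Let_def)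
    show "nrm (direct_sum_mat G H) \<le> 1"
      using nrm_direct_sum[OF f(1) g(1) f(2) g(2)] f(3) g(3) by simp
    show "f y + g y = defect (m + k) (direct_sum_mat G H) (\<lambda>j. if j < m then v j else w (j - m)) y
        + (\<tau> + \<sigma>) * excess y" for y
      unfolding defect_direct_sum[OF f(2) g(2)] by (simp add: f(5) g(5) algebra_simps)
  qed (use f g in auto)
next
  fix f and a :: real assume "f \<in> gram_cone" and a: "0 < a"
  then obtain m G v \<tau> where f: "0 < m" "G \<in> matrices_over m A" "nrm G \<le> 1" "0 < \<tau>"
      "f = (\<lambda>y. defect m G v y + \<tau> * excess y)"
    unfolding gram_cone_def by blast
  show "(\<lambda>y. a * f y) \<in> gram_cone"
  proof (rule gram_coneI[OF f(1-3)])
    show "a * f y = defect m G (\<lambda>j i. of_real (sqrt a) * v j i) y + (a * \<tau>) * excess y" for y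
      unfolding defect_scale using a by (simp add: f(5) algebra_simps)
  qed (use f a in simp)
qed

text \<open>For empty \<open>F\<close> the zero matrix would represent the coset of
  \<open>G0\<close>, contradicting \<open>gt\<close>.\<close>

lemma d_pos: "0 < d"
proof (rule ccontr)
  assume "\<not> 0 < d"
  with bij n have "F = {}" by (auto simp: bij_betw_def)
  have zero: "0\<^sub>m n n \<in> matrices_over n A" using zero_in by (auto simp: matrices_over_iff)
  have "quotient_norm A nrm F G0 \<le> nrm (0\<^sub>m n n)"
    by (rule quotient_norm_le[OF n G0 zero]) (simp add: agree_on_def \<open>F = {}\<close>)
  also have "\<dots> = 0" using nrm_eq_0_iff[OF n zero] by simp
  finally show False using gt by simp
qed

lemma scale_to_unit_sphere:
  assumes "\<exists>i<d. y i \<noteq> 0"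
  obtains c where "c \<noteq> 0" "(\<lambda>i. c * y i) \<in> unit_sphere d"
proof -
  define N where "N = (\<Sum>i<d. (cmod (y i))\<^sup>2)"
  have "0 < N" unfolding N_def using assms by (auto intro: sum_pos2)
  have "(\<Sum>i<d. (cmod (of_real (1 / sqrt N) * y i))\<^sup>2) = 1 / N * N"
    unfolding N_def[symmetric] norm_mult power_mult_distrib sum_distrib_left[symmetric]
    using \<open>0 < N\<close> by (simp add: N_def norm_divide power_divide)
  with \<open>0 < N\<close> have "(\<lambda>i. of_real (1 / sqrt N) * y i) \<in> unit_sphere d"
    by (simp add: unit_sphere_def)
  with \<open>0 < N\<close> show thesis by (intro that[of "of_real (1 / sqrt N)"]) auto
qed

text \<open>Arbitrary vectors become values of functions in \<open>A\<close>: each entry of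
  \<open>V\<close> interpolates, over the points of \<open>F\<close>, the coordinates that belong to
  its column.\<close>

lemma lift_vectors:
  fixes v :: "nat \<Rightarrow> nat \<Rightarrow> complex"
  obtains V where "\<forall>j<m. \<forall>c<n. V $$ (j, c) \<in> A"
    "\<forall>j<m. \<forall>i<d. (V $$ (j, co i)) (pt i) = v j i"
proof -
  define idx where "idx = inv_into {..<d} (\<lambda>i. (pt i, co i))"
  have idx: "idx (pt i, co i) = i" if "i < d" for i
    unfolding idx_def using bij_betw_imp_inj_on[OF bij] that by (intro inv_into_f_eq) auto
  have "\<exists>f\<in>A. \<forall>x\<in>F. f x = v j (idx (x, c))" for j c
    using interpolation[OF F, of "\<lambda>x. v j (idx (x, c))"] by metis
  then obtain f where f: "\<And>j c. f j c \<in> A" "\<And>j c x. x \<in> F \<Longrightarrow> f j c x = v j (idx (x, c))"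
    by metis
  have "co i < n" "pt i \<in> F" if "i < d" for i
    using bij that by (auto simp: bij_betw_def)
  with f idx show thesis
    by (intro that[of "mat m n (\<lambda>(j, c). f j c)"]) auto
qed

text \<open>A member at most -1 on the sphere is negative definite by homogeneity. With \<tau>
  normalized to 1 and the vectors lifted to functions, it bounds the quotient norm of
  \<open>G0\<close> by 1, contradicting \<open>gt\<close>.\<close>

lemma gram_cone_not_negative:
  assumes "f \<in> gram_cone"
  shows "\<exists>y\<in>unit_sphere d. -1 < f y"
proof (rule ccontr)
  assume neg: "\<not> ?thesis"
  from assms obtain m G v \<tau> where m: "0 < m" and G: "G \<in> matrices_over m A" "nrm G \<le> 1" and \<tau>: "0 < \<tau>"
    and f: "f = (\<lambda>y. defect m G v y + \<tau> * excess y)"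
    unfolding gram_cone_def by blast
  define w where "w j i = of_real (1 / sqrt \<tau>) * v j i" for j i
  have less: "defect m G w y + excess y < 0" if y: "\<exists>i<d. y i \<noteq> 0" for y
  proof -
    from y obtain c where c: "c \<noteq> 0" "(\<lambda>i. c * y i) \<in> unit_sphere d"
      by (rule scale_to_unit_sphere)
    with neg have "f (\<lambda>i. c * y i) < 0" by fastforce
    then have "(cmod c)\<^sup>2 * (defect m G v y + \<tau> * excess y) < 0"
      by (simp add: f defect_scale_right excess_scale_right algebra_simps)
    with c have "defect m G v y + \<tau> * excess y < 0" by (simp add: mult_less_0_iff)
    then have "(defect m G v y + \<tau> * excess y) / \<tau> < 0" using \<tau> by (simp add: divide_less_0_iff)
    then show ?thesis
      unfolding w_def defect_scale using \<tau> by (simp add: add_divide_distrib power_divide norm_divide)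
  qed
  obtain V where V: "\<forall>j<m. \<forall>c<n. V $$ (j, c) \<in> A"
    and Vw: "\<forall>j<m. \<forall>i<d. (V $$ (j, co i)) (pt i) = w j i"
    by (rule lift_vectors)
  have "quotient_norm A nrm F G0 \<le> 1"
  proof (rule quotient_norm_le_one[OF n m G0 G _ bij])
    fix y :: "nat \<Rightarrow> complex" assume "\<exists>i<d. y i \<noteq> 0"
    from less[OF this] show "(\<Sum>j<m. (cmod (\<Sum>i<d. (V $$ (j, co i)) (pt i) * y i))\<^sup>2)
        + (\<Sum>r<n. (cmod (\<Sum>i<d. (G0 $$ (r, co i)) (pt i) * y i))\<^sup>2)
      < (\<Sum>j<m. (cmod (\<Sum>i<d. (\<Sum>l<m. (G $$ (j, l)) (pt i) * (V $$ (l, co i)) (pt i)) * y i))\<^sup>2)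
        + (\<Sum>r<n. (cmod (\<Sum>i<d. (if co i = r then 1 else 0) * y i))\<^sup>2)"
      by (simp add: Vw defect_def excess_def rank_one_def act_def row0_def e_vec_def)
  qed (use V in blast)
  with gt show False by simp
qed

text \<open>The functional separating \<open>gram_cone\<close> yields \<open>q\<close>. Its values
  on members with \<tau> -> 0 give contractivity, the member with \<open>v = 0\<close> gives the
  inequality between \<open>e_vec\<close> and \<open>row0\<close>, and normalization excludes
  \<open>q = 0\<close>.\<close>

lemma separating_gram:
  obtains q where "\<And>i j. i < d \<Longrightarrow> j < d \<Longrightarrow> q j i = cnj (q i j)"
    "\<And>v. 0 \<le> quad d q v"
    "\<And>m G v. 0 < m \<Longrightarrow> G \<in> matrices_over m A \<Longrightarrow>
      (\<Sum>r<m. quad d q (act m G v r)) \<le> (nrm G)\<^sup>2 * (\<Sum>j<m. quad d q (v j))"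
    "(\<Sum>r<n. quad d q (e_vec r)) \<le> (\<Sum>r<n. quad d q (row0 r))"
    "0 < (\<Sum>r<n. quad d q (e_vec r))"
proof -
  let ?S = "unit_sphere d"
  have "\<exists>i<d. (\<lambda>_. 1 :: complex) i \<noteq> 0" using d_pos by auto
  then have "?S \<noteq> {}" by (rule scale_to_unit_sphere) auto
  with gram_cone_not_negative obtain \<phi> where \<phi>: "positive_functional ?S \<phi>"
    and pos: "\<And>f. bounded_fun ?S f \<Longrightarrow> f \<in> gram_cone \<Longrightarrow> 0 \<le> \<phi> f"
    using positive_functional_on_cone[OF gram_cone_cone, of ?S] by metis
  interpret positive_functional ?S \<phi> by fact
  obtain q where herm: "\<forall>i<d. \<forall>j<d. q j i = cnj (q i j)" and "\<forall>v. quad d q v = \<phi> (rank_one d v)"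
    by (rule positive_functional_gram[OF \<phi>])
  then have q: "quad d q v = \<phi> (rank_one d v)" for v by blast
  have q_nonneg: "0 \<le> quad d q v" for v
    unfolding q by (intro nonneg bounded_rank_one rank_one_nonneg)
  have q_scale: "quad d q (\<lambda>i. c * v i) = (cmod c)\<^sup>2 * quad d q v" for c v
    unfolding q rank_one_scale[abs_def] by (rule scale[OF bounded_rank_one])
  have bdd_sum: "bounded_fun ?S (\<lambda>y. \<Sum>j<k. rank_one d (v j) y)" for k :: nat and v
    by (intro bounded_fun_sum bounded_rank_one) simp
  have phi_sum: "\<phi> (\<lambda>y. \<Sum>j<k. rank_one d (v j) y) = (\<Sum>j<k. quad d q (v j))" for k :: nat and v
    unfolding q by (rule sum) (auto intro: bounded_rank_one)
  have bdd_diff: "bounded_fun ?S (\<lambda>y. f y - g y)" if "bounded_fun ?S f" "bounded_fun ?S g" for f g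
    using bounded_fun_add[OF that(1) bounded_fun_scale[OF that(2), of "-1"]] by simp
  have bdd: "bounded_fun ?S (defect m G v)" "bounded_fun ?S excess" for m G v
    unfolding defect_def[abs_def] excess_def[abs_def] by (intro bdd_diff bdd_sum)+
  have phi_defect: "\<phi> (defect m G v) = (\<Sum>j<m. quad d q (v j)) - (\<Sum>r<m. quad d q (act m G v r))" for m G v
    unfolding defect_def[abs_def] diff[OF bdd_sum bdd_sum] phi_sum ..
  have phi_excess: "\<phi> excess = (\<Sum>r<n. quad d q (row0 r)) - (\<Sum>r<n. quad d q (e_vec r))"
    unfolding excess_def[abs_def] diff[OF bdd_sum bdd_sum] phi_sum ..
  have pos': "0 \<le> \<phi> (defect m G v) + \<tau> * \<phi> excess"
    if "0 < m" "G \<in> matrices_over m A" "nrm G \<le> 1" "0 < \<tau>" for m G v \<tau>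
    using pos[OF bounded_fun_add[OF bdd(1) bounded_fun_scale[OF bdd(2)]] gram_coneI[OF that refl]]
    by (simp add: add bdd scale bounded_fun_scale)
  have contr1: "0 \<le> \<phi> (defect m G v)"
    if G: "0 < m" "G \<in> matrices_over m A" "nrm G \<le> 1" for m G v
  proof (rule field_le_epsilon)
    fix e :: real assume "0 < e"
    \<comment> \<open>Chosen so that the term with \<open>excess\<close> costs at most
      \<open>e\<close>.\<close>
    define \<tau> where "\<tau> = e / (\<bar>\<phi> excess\<bar> + 1)"
    have "0 < \<tau>" using \<open>0 < e\<close> by (simp add: \<tau>_def)
    from pos'[OF G this, of v] have "0 \<le> \<phi> (defect m G v) + \<tau> * \<phi> excess" .
    also have "\<tau> * \<phi> excess \<le> \<tau> * (\<bar>\<phi> excess\<bar> + 1)"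
      using \<open>0 < \<tau>\<close> by (intro mult_left_mono) auto
    also have "\<dots> = e" by (simp add: \<tau>_def)
    finally show "0 \<le> \<phi> (defect m G v) + e" by simp
  qed
  have contr: "(\<Sum>r<m. quad d q (act m G v r)) \<le> (nrm G)\<^sup>2 * (\<Sum>j<m. quad d q (v j))"
    if "0 < m" and G: "G \<in> matrices_over m A" for m G v
  proof (cases "nrm G = 0")
    case True
    with nrm_eq_0_iff[OF that] have "act m G v r = (\<lambda>i. 0)" if "r < m" for r
      using that by (auto simp: act_def)
    moreover have "quad d q (\<lambda>i. 0) = 0" by (simp add: quad_def)
    ultimately show ?thesis by (simp add: True)
  next
    case False
    with nrm_nonneg[OF that] have g: "0 < nrm G" by simp
    define H where "H = map_mat (fun_scale (of_real (1 / nrm G))) G"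
    have H: "H \<in> matrices_over m A" using G by (auto simp: H_def matrices_over_iff intro!: scale_in)
    have nrmH: "nrm H \<le> 1" unfolding H_def nrm_scale[OF that] using g by (simp add: norm_divide)
    have "act m H v r = (\<lambda>i. of_real (1 / nrm G) * act m G v r i)" if "r < m" for r
      using that G by (auto simp: act_def H_def matrices_over_iff fun_scale_def sum_distrib_left
          fun_eq_iff mult.assoc)
    then have "quad d q (act m H v r) = (1 / nrm G)\<^sup>2 * quad d q (act m G v r)" if "r < m" for r
      using that by (simp only: q_scale) (simp add: norm_divide power_divide)
    then have "(\<Sum>r<m. quad d q (act m H v r)) = (1 / nrm G)\<^sup>2 * (\<Sum>r<m. quad d q (act m G v r))"
      by (simp add: sum_distrib_left)
    with contr1[OF \<open>0 < m\<close> H nrmH, of v] g show ?thesis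
      by (simp add: phi_defect power_divide field_simps)
  qed
  have "0 \<le> \<phi> excess"
  proof -
    have one: "1\<^sub>m 1 \<in> matrices_over 1 A" using one_closed by (auto simp: matrices_over_iff)
    have "defect 1 (1\<^sub>m 1) (\<lambda>_ _. 0) = (\<lambda>_. 0)"
      by (simp add: defect_def[abs_def] rank_one_def act_def)
    moreover have "0 \<le> \<phi> (defect 1 (1\<^sub>m 1) (\<lambda>_ _. 0)) + 1 * \<phi> excess"
      using nrm_one by (intro pos' one) simp_all
    ultimately show ?thesis using zero by simp
  qed
  then have excess: "(\<Sum>r<n. quad d q (e_vec r)) \<le> (\<Sum>r<n. quad d q (row0 r))"
    by (simp add: phi_excess)
  \<comment> \<open>On the unit sphere the forms of the basis vectors \<delta> add up to 1, so
    \<open>q\<close> is positive at some \<open>\<delta> i\<close>. This vector is \<open>f\<close>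
    acting on \<open>e_vec (co i)\<close>, with \<open>f\<close> interpolating the indicator of
    \<open>pt i\<close>, and contractivity passes positivity on to the generator.\<close>
  have "0 < (\<Sum>r<n. quad d q (e_vec r))"
  proof -
    define \<delta> where "\<delta> i k = (if k = i then 1 else 0 :: complex)" for i k :: nat
    have "rank_one d (\<delta> i) y = (cmod (y i))\<^sup>2" if "i < d" for i y
    proof -
      have "(\<Sum>k<d. \<delta> i k * y k) = (\<Sum>k<d. if k = i then y i else 0)"
        by (intro sum.cong) (auto simp: \<delta>_def)
      with that show ?thesis by (simp add: rank_one_def)
    qed
    then have "\<phi> (\<lambda>y. \<Sum>i<d. rank_one d (\<delta> i) y) = 1"
      by (intro one bdd_sum) (simp add: unit_sphere_def)
    then have "(\<Sum>i<d. quad d q (\<delta> i)) = 1" by (simp add: phi_sum)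
    then obtain i where i: "i < d" "0 < quad d q (\<delta> i)"
      using sum_nonpos[of "{..<d}" "\<lambda>i. quad d q (\<delta> i)"] by fastforce
    have co: "co i < n" using bij i(1) by (auto simp: bij_betw_def)
    obtain f where f: "f \<in> A" "\<And>x. x \<in> F \<Longrightarrow> f x = (if x = pt i then 1 else 0)"
      using interpolation[OF F, of "\<lambda>x. if x = pt i then 1 else 0"] by metis
    have fG: "mat 1 1 (\<lambda>_. f) \<in> matrices_over 1 A" using f by (auto simp: matrices_over_iff)
    have "quad d q (act 1 (mat 1 1 (\<lambda>_. f)) (\<lambda>_. e_vec (co i)) 0) = quad d q (\<delta> i)"
    proof (rule quad_cong)
      fix k assume k: "k < d"
      then have "pt k \<in> F" using bij by (auto simp: bij_betw_def)
      moreover have "k = i \<longleftrightarrow> pt k = pt i \<and> co k = co i"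
        using bij_betw_imp_inj_on[OF bij] k i(1) by (auto simp: inj_on_def)
      ultimately show "act 1 (mat 1 1 (\<lambda>_. f)) (\<lambda>_. e_vec (co i)) 0 k = \<delta> i k"
        using f(2) by (auto simp: act_def e_vec_def \<delta>_def)
    qed
    with contr[OF _ fG, of "\<lambda>_. e_vec (co i)"] i(2)
    have "0 < (nrm (mat 1 1 (\<lambda>_. f)))\<^sup>2 * quad d q (e_vec (co i))" by simp
    then have "0 < quad d q (e_vec (co i))"
      using q_nonneg[of "e_vec (co i)"] by (auto simp: zero_less_mult_iff)
    with co q_nonneg show ?thesis by (intro sum_pos2[of _ "co i"]) auto
  qed
  with that[of q] herm q_nonneg contr excess show thesis by blast
qed

end

end

section \<open>Diagonal representations\<close>

lemma sum_lessThan_mult: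
  "(\<Sum>k<m * d. f k) = (\<Sum>j<m. \<Sum>l<d. f (j * d + l))"
  for f :: "nat \<Rightarrow> 'a::comm_monoid_add"
proof (induction m)
  case (Suc m)
  have "Suc m * d = m * d + d" by simp
  then show ?case by (simp only: sum_lessThan_add Suc.IH sum.lessThan_Suc)
qed simp

definition block_vec :: "nat \<Rightarrow> 'a vec \<Rightarrow> nat \<Rightarrow> 'a vec" where
  "block_vec d u j = vec d (\<lambda>l. u $ (j * d + l))"

lemma block_index_less:
  fixes j d l m :: nat
  assumes "j < m" "l < d"
  shows "j * d + l < m * d"
proof -
  have "j * d + l < Suc j * d" using assms by simp
  also have "\<dots> \<le> m * d" using assms by (intro mult_le_mono1) simp
  finally show ?thesis .
qed

lemma cvec_norm_blocks:
  assumes "dim_vec u = m * d"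
  shows "(cvec_norm u)\<^sup>2 = (\<Sum>j<m. (cvec_norm (block_vec d u j))\<^sup>2)"
  unfolding cvec_norm_power2 assms sum_lessThan_mult by (simp add: block_vec_def)

lemma amplify_mult_vec_nth:
  assumes G: "G \<in> carrier_mat m m" and u: "u \<in> carrier_vec (m * d)"
    and \<pi>: "\<And>i j. i < m \<Longrightarrow> j < m \<Longrightarrow> \<pi> (G $$ (i, j)) \<in> carrier_mat d d"
    and rs: "i < m" "s < d"
  shows "(amplify d \<pi> G *\<^sub>v u) $ (i * d + s) = (\<Sum>j<m. (\<pi> (G $$ (i, j)) *\<^sub>v block_vec d u j) $ s)"
proof -
  have "(amplify d \<pi> G *\<^sub>v u) $ (i * d + s)
      = (\<Sum>k<m * d. \<pi> (G $$ (i, k div d)) $$ (s, k mod d) * u $ k)"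
    using G u rs block_index_less[OF rs]
    by (subst mult_mat_vec_nth[of _ _ "m * d"]) (auto simp: amplify_def)
  also have "\<dots> = (\<Sum>j<m. \<Sum>l<d. \<pi> (G $$ (i, j)) $$ (s, l) * u $ (j * d + l))"
    unfolding sum_lessThan_mult by (intro sum.cong) auto
  also have "\<dots> = (\<Sum>j<m. (\<pi> (G $$ (i, j)) *\<^sub>v block_vec d u j) $ s)"
  proof (intro sum.cong refl)
    fix j assume "j \<in> {..<m}"
    with \<pi>[OF rs(1), of j] rs show "(\<Sum>l<d. \<pi> (G $$ (i, j)) $$ (s, l) * u $ (j * d + l))
        = (\<pi> (G $$ (i, j)) *\<^sub>v block_vec d u j) $ s"
      by (subst mult_mat_vec_nth[of _ _ d]) (auto simp: block_vec_def)
  qed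
  finally show ?thesis .
qed

definition diag_fun :: "nat \<Rightarrow> (nat \<Rightarrow> 'x) \<Rightarrow> ('x \<Rightarrow> complex) \<Rightarrow> complex mat" where
  "diag_fun d pt f = mat d d (\<lambda>(i, j). if i = j then f (pt i) else 0)"

lemma diag_fun_carrier: "diag_fun d pt f \<in> carrier_mat d d"
  by (simp add: diag_fun_def)

lemma diag_fun_mult_vec:
  assumes "v \<in> carrier_vec d"
  shows "diag_fun d pt f *\<^sub>v v = vec d (\<lambda>i. f (pt i) * v $ i)"
proof (rule eq_vecI)
  fix i assume "i < dim_vec (vec d (\<lambda>i. f (pt i) * v $ i))"
  then have i: "i < d" by simp
  have "(diag_fun d pt f *\<^sub>v v) $ i = (\<Sum>j<d. diag_fun d pt f $$ (i, j) * v $ j)"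
    using i assms by (intro mult_mat_vec_nth) (auto simp: diag_fun_def)
  also have "\<dots> = (\<Sum>j<d. if j = i then f (pt i) * v $ i else 0)"
    using i by (intro sum.cong) (auto simp: diag_fun_def)
  finally show "(diag_fun d pt f *\<^sub>v v) $ i = vec d (\<lambda>i. f (pt i) * v $ i) $ i" using i by simp
qed (simp add: diag_fun_def)

lemma diag_fun_add: "diag_fun d pt (f + g) = diag_fun d pt f + diag_fun d pt g"
  and diag_fun_scale: "diag_fun d pt (fun_scale c f) = c \<cdot>\<^sub>m diag_fun d pt f"
  by (auto simp: diag_fun_def fun_scale_def)

lemma diag_fun_mult: "diag_fun d pt (f * g) = diag_fun d pt f * diag_fun d pt g"
proof (rule eq_matI)
  fix i j assume "i < dim_row (diag_fun d pt f * diag_fun d pt g)" "j < dim_col (diag_fun d pt f * diag_fun d pt g)"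
  then have ij: "i < d" "j < d" by (auto simp: diag_fun_def)
  have "(diag_fun d pt f * diag_fun d pt g) $$ (i, j)
      = (\<Sum>k<d. diag_fun d pt f $$ (i, k) * diag_fun d pt g $$ (k, j))"
    by (rule mult_mat_nth[OF diag_fun_carrier diag_fun_carrier ij])
  also have "\<dots> = (\<Sum>k<d. if k = i then f (pt i) * diag_fun d pt g $$ (i, j) else 0)"
    using ij by (intro sum.cong) (auto simp: diag_fun_def)
  finally show "diag_fun d pt (f * g) $$ (i, j) = (diag_fun d pt f * diag_fun d pt g) $$ (i, j)"
    using ij by (simp add: diag_fun_def)
qed (auto simp: diag_fun_def)

context
  fixes R R' :: "complex mat" and d :: nat and pt :: "nat \<Rightarrow> 'x"
  assumes R: "R \<in> carrier_mat d d" and R': "R' \<in> carrier_mat d d"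
    and R'R: "R' * R = 1\<^sub>m d" and RR': "R * R' = 1\<^sub>m d"
begin

text \<open>Diagonal multiplication by \<open>f\<close>, written in the coordinates
  \<open>R v\<close> in which the form given by \<open>R\<close> becomes Euclidean.\<close>

definition conj_diag :: "('x \<Rightarrow> complex) \<Rightarrow> complex mat" where
  "conj_diag f = R * diag_fun d pt f * R'"

lemma conj_diag_carrier: "conj_diag f \<in> carrier_mat d d"
  unfolding conj_diag_def using R R' diag_fun_carrier[of d pt f] by (meson mult_carrier_mat)

lemma conj_diag_add: "conj_diag (f + g) = conj_diag f + conj_diag g"
proof -
  note D = diag_fun_carrier[of d pt]
  have "conj_diag (f + g) = (R * diag_fun d pt f + R * diag_fun d pt g) * R'"
    unfolding conj_diag_def diag_fun_add mult_add_distrib_mat[OF R D D] ..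
  also have "\<dots> = conj_diag f + conj_diag g"
    unfolding conj_diag_def
    by (rule add_mult_distrib_mat[OF mult_carrier_mat[OF R D] mult_carrier_mat[OF R D] R'])
  finally show ?thesis .
qed

lemma conj_diag_scale: "conj_diag (fun_scale c f) = c \<cdot>\<^sub>m conj_diag f"
proof -
  note D = diag_fun_carrier[of d pt]
  show ?thesis unfolding conj_diag_def diag_fun_scale mult_smult_distrib[OF R D]
    by (rule mult_smult_assoc_mat[OF mult_carrier_mat[OF R D] R'])
qed

lemma conj_diag_mult: "conj_diag (f * g) = conj_diag f * conj_diag g"
proof -
  let ?D = "diag_fun d pt"
  note D = diag_fun_carrier[of d pt]
  note RD = mult_carrier_mat[OF R D]
  have "conj_diag f * conj_diag g = R * ?D f * (R' * (R * ?D g * R'))"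
    unfolding conj_diag_def by (rule assoc_mult_mat[OF RD R' mult_carrier_mat[OF RD R']])
  also have "R' * (R * ?D g * R') = R' * R * ?D g * R'"
    using assoc_mult_mat[OF R' RD R'] assoc_mult_mat[OF R' R D] by simp
  also have "\<dots> = ?D g * R'" unfolding R'R using left_mult_one_mat[OF D] by simp
  also have "R * ?D f * (?D g * R') = R * (?D f * ?D g) * R'"
    using assoc_mult_mat[OF RD D R'] assoc_mult_mat[OF R D D] by simp
  also have "\<dots> = conj_diag (f * g)" by (simp add: conj_diag_def diag_fun_mult)
  finally show ?thesis ..
qed

lemma conj_diag_mult_vec:
  assumes w: "w \<in> carrier_vec d"
  shows "conj_diag f *\<^sub>v (R *\<^sub>v w) = R *\<^sub>v vec d (\<lambda>i. f (pt i) * w $ i)"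
proof -
  note D = diag_fun_carrier[of d pt]
  note RD = mult_carrier_mat[OF R D]
  have Rw: "R *\<^sub>v w \<in> carrier_vec d" by (rule mult_mat_vec_carrier[OF R w])
  have "conj_diag f *\<^sub>v (R *\<^sub>v w) = R * diag_fun d pt f *\<^sub>v (R' *\<^sub>v (R *\<^sub>v w))"
    unfolding conj_diag_def by (rule assoc_mult_mat_vec[OF RD R' Rw])
  also have "R' *\<^sub>v (R *\<^sub>v w) = w"
    using assoc_mult_mat_vec[OF R' R w] w by (simp add: R'R)
  also have "R * diag_fun d pt f *\<^sub>v w = R *\<^sub>v (diag_fun d pt f *\<^sub>v w)"
    by (rule assoc_mult_mat_vec[OF R D w])
  finally show ?thesis by (simp add: diag_fun_mult_vec[OF w])
qed

text \<open>Since \<open>R' * R\<close> is the identity, writing every block as \<open>R\<close>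
  applied to \<open>w j\<close> reduces the amplification to the diagonal action on the
  \<open>w j\<close>, followed by \<open>R\<close>.\<close>

lemma cvec_norm_amplify_conj_diag:
  assumes G: "G \<in> carrier_mat m m" and u: "u \<in> carrier_vec (m * d)"
    and w: "\<And>j. j < m \<Longrightarrow> w j \<in> carrier_vec d"
    and blocks: "\<And>j. j < m \<Longrightarrow> block_vec d u j = R *\<^sub>v w j"
  shows "(cvec_norm (amplify d conj_diag G *\<^sub>v u))\<^sup>2
    = (\<Sum>r<m. (cvec_norm (R *\<^sub>v vec d (\<lambda>i. \<Sum>l<m. (G $$ (r, l)) (pt i) * w l $ i)))\<^sup>2)"
proof -
  have "block_vec d (amplify d conj_diag G *\<^sub>v u) r
      = R *\<^sub>v vec d (\<lambda>i. \<Sum>l<m. (G $$ (r, l)) (pt i) * w l $ i)" if r: "r < m" for r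
  proof (rule eq_vecI)
    let ?z = "vec d (\<lambda>i. \<Sum>l<m. (G $$ (r, l)) (pt i) * w l $ i)"
    fix s assume "s < dim_vec (R *\<^sub>v ?z)"
    then have s: "s < d" using R by simp
    have "block_vec d (amplify d conj_diag G *\<^sub>v u) r $ s
        = (\<Sum>l<m. (conj_diag (G $$ (r, l)) *\<^sub>v block_vec d u l) $ s)"
      using amplify_mult_vec_nth[OF G u conj_diag_carrier r s] s
      by (simp add: block_vec_def[of d "amplify d conj_diag G *\<^sub>v u"] del: index_mult_mat_vec)
    also have "\<dots> = (\<Sum>l<m. (R *\<^sub>v vec d (\<lambda>i. (G $$ (r, l)) (pt i) * w l $ i)) $ s)"
      by (simp add: blocks conj_diag_mult_vec w del: index_mult_mat_vec)
    also have "\<dots> = (\<Sum>l<m. \<Sum>i<d. R $$ (s, i) * ((G $$ (r, l)) (pt i) * w l $ i))"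
      using R s by (simp add: mult_mat_vec_nth[of _ _ d] del: index_mult_mat_vec)
    also have "\<dots> = (\<Sum>i<d. \<Sum>l<m. R $$ (s, i) * ((G $$ (r, l)) (pt i) * w l $ i))"
      by (rule sum.swap)
    also have "\<dots> = (R *\<^sub>v ?z) $ s"
      using R s by (simp add: mult_mat_vec_nth[of _ _ d] sum_distrib_left del: index_mult_mat_vec)
    finally show "block_vec d (amplify d conj_diag G *\<^sub>v u) r $ s = (R *\<^sub>v ?z) $ s" .
  qed (use R in \<open>simp add: block_vec_def\<close>)
  moreover have "dim_vec (amplify d conj_diag G *\<^sub>v u) = m * d"
    using G by (simp add: amplify_def)
  ultimately show ?thesis by (simp add: cvec_norm_blocks)
qed

end

section \<open>Norming homomorphisms\<close>

lemma quad_add_diag: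
  "quad d (\<lambda>i j. q i j + (if i = j then of_real \<epsilon> else 0)) v = quad d q v + \<epsilon> * (\<Sum>i<d. (cmod (v i))\<^sup>2)"
proof -
  have "(\<Sum>i<d. \<Sum>j<d. cnj (v i) * (q i j + (if i = j then of_real \<epsilon> else 0)) * v j)
      = (\<Sum>i<d. \<Sum>j<d. cnj (v i) * q i j * v j + (if j = i then of_real \<epsilon> * (v i * cnj (v i)) else 0))"
    by (intro sum.cong) (auto simp: algebra_simps)
  also have "\<dots> = (\<Sum>i<d. \<Sum>j<d. cnj (v i) * q i j * v j) + (\<Sum>i<d. of_real (\<epsilon> * (cmod (v i))\<^sup>2))"
    by (simp add: sum.distrib complex_norm_square[symmetric])
  finally show ?thesis by (simp add: quad_def sum_distrib_left)
qed

lemma op_norm_smult_le: "op_norm (c \<cdot>\<^sub>m L) \<le> cmod c * op_norm L"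
proof (rule op_norm_leI)
  fix v :: "complex vec" assume "v \<in> carrier_vec (dim_col (c \<cdot>\<^sub>m L))"
  then have v: "v \<in> carrier_vec (dim_col L)" by simp
  have "c \<cdot>\<^sub>m L *\<^sub>v v = c \<cdot>\<^sub>v (L *\<^sub>v v)" using v by (intro eq_vecI) (auto simp: scalar_prod_def sum_distrib_left mult.assoc)
  with cvec_norm_mult_le[OF v] show "cvec_norm (c \<cdot>\<^sub>m L *\<^sub>v v) \<le> cmod c * op_norm L * cvec_norm v"
    by (simp add: cvec_norm_smult mult.assoc mult_left_mono)
qed (simp add: op_norm_nonneg)

context function_operator_algebra
begin

text \<open>The Euclidean form is itself contractive for the diagonal action, point by point, so
  adding a multiple of it to \<open>q\<close> preserves contractivity.\<close>

lemma eval_blocks_contractive: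
  assumes "0 < m" "G \<in> matrices_over m A"
  shows "(\<Sum>r<m. \<Sum>i<d. (cmod (\<Sum>l<m. (G $$ (r, l)) (pt i) * v l i))\<^sup>2)
    \<le> (nrm G)\<^sup>2 * (\<Sum>l<m. \<Sum>i<d. (cmod (v l i))\<^sup>2)"
proof -
  have "(\<Sum>r<m. \<Sum>i<d. (cmod (\<Sum>l<m. (G $$ (r, l)) (pt i) * v l i))\<^sup>2)
      = (\<Sum>i<d. \<Sum>r<m. (cmod (\<Sum>l<m. (G $$ (r, l)) (pt i) * v l i))\<^sup>2)"
    by (rule sum.swap)
  also have "\<dots> \<le> (\<Sum>i<d. (nrm G)\<^sup>2 * (\<Sum>l<m. (cmod (v l i))\<^sup>2))"
    by (intro sum_mono eval_mat_contractive assms)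
  also have "\<dots> = (nrm G)\<^sup>2 * (\<Sum>l<m. \<Sum>i<d. (cmod (v l i))\<^sup>2)"
    unfolding sum_distrib_left[symmetric] by (subst sum.swap) simp
  finally show ?thesis .
qed

text \<open>The form from \<open>separating_gram\<close> may be degenerate. Adding \<epsilon> times
  the Euclidean form makes it definite, and the loss is absorbed by \<open>c < 1\<close>; the
  homomorphism is the diagonal action conjugated by the factor \<open>R\<close> of the new
  form.\<close>

lemma exists_near_norming_hom:
  assumes n: "0 < n" and F: "finite F" and G0: "G0 \<in> matrices_over n A"
    and gt: "1 < quotient_norm A nrm F G0" and c: "0 < c" "c < 1"
  shows "\<exists>k \<pi>. 0 < k \<and> completely_contractive_hom fun_scale A nrm k \<pi> \<and> c \<le> op_norm (amplify k \<pi> G0)"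
proof -
  obtain h where h: "bij_betw h {0..<card (F \<times> {..<n})} (F \<times> {..<n})"
    using ex_bij_betw_nat_finite[of "F \<times> {..<n}"] F by auto
  define d where "d = card (F \<times> {..<n})"
  define pt where "pt i = fst (h i)" for i
  define co where "co i = snd (h i)" for i
  have bij: "bij_betw (\<lambda>i. (pt i, co i)) {..<d} (F \<times> {..<n})"
    using h by (simp add: pt_def co_def d_def atLeast0LessThan)
  note ctxt = n F G0 bij gt
  have d: "0 < d" by (rule d_pos[OF ctxt])
  obtain q where herm: "\<And>i j. i < d \<Longrightarrow> j < d \<Longrightarrow> q j i = cnj (q i j)"
    and nonneg: "\<And>v. 0 \<le> quad d q v"
    and contr: "\<And>m G v. 0 < m \<Longrightarrow> G \<in> matrices_over m A \<Longrightarrow>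
      (\<Sum>r<m. quad d q (act pt m G v r)) \<le> (nrm G)\<^sup>2 * (\<Sum>j<m. quad d q (v j))"
    and excess: "(\<Sum>r<n. quad d q (e_vec co r)) \<le> (\<Sum>r<n. quad d q (row0 pt co G0 r))"
    and pos: "0 < (\<Sum>r<n. quad d q (e_vec co r))"
    using separating_gram[OF ctxt] by metis
  define s where "s = (\<Sum>r<n. quad d q (e_vec co r))"
  \<comment> \<open>The generators have total Euclidean norm squared \<open>d\<close>, so this
    choice makes the norm squared of the test vector \<open>u\<close> equal to
    \<open>s * (2 - c^2)\<close>.\<close>
  define \<epsilon> where "\<epsilon> = s * (1 - c\<^sup>2) / d"
  have c2: "c\<^sup>2 < 1" using c by (simp add: power_less_one_iff)
  have \<epsilon>: "0 < \<epsilon>" using pos c2 d by (simp add: \<epsilon>_def s_def)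
  define q' where "q' i j = q i j + (if i = j then of_real \<epsilon> else 0)" for i j
  have q': "quad d q' v = quad d q v + \<epsilon> * (\<Sum>i<d. (cmod (v i))\<^sup>2)" for v
    unfolding q'_def by (rule quad_add_diag)
  obtain R R' where R: "R \<in> carrier_mat d d" and R': "R' \<in> carrier_mat d d"
    and RR': "R * R' = 1\<^sub>m d" and R'R: "R' * R = 1\<^sub>m d"
    and norm_R: "\<And>v. v \<in> carrier_vec d \<Longrightarrow> (cvec_norm (R *\<^sub>v v))\<^sup>2 = quad d q' (\<lambda>i. v $ i)"
  proof (rule posdef_gram_factorization[of d q', folded quad_def])
    show "q' j i = cnj (q' i j)" if "i < d" "j < d" for i j
      using herm[OF that] by (simp add: q'_def)
    show "0 < quad d q' v" if "\<exists>i<d. v i \<noteq> 0" for v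
    proof -
      have "0 < (\<Sum>i<d. (cmod (v i))\<^sup>2)" using that by (auto intro: sum_pos2)
      with \<epsilon> nonneg[of v] show ?thesis unfolding q' by (simp add: add_nonneg_pos)
    qed
  qed (use that in blast)
  note conj = R R' R'R RR'
  define \<pi> where "\<pi> = conj_diag R R' d pt"
  have norm_\<pi>: "(cvec_norm (amplify d \<pi> G *\<^sub>v u))\<^sup>2 = (\<Sum>r<m. quad d q' (act pt m G (\<lambda>l i. w l $ i) r))"
    if "G \<in> carrier_mat m m" "u \<in> carrier_vec (m * d)" "\<And>j. j < m \<Longrightarrow> w j \<in> carrier_vec d"
      "\<And>j. j < m \<Longrightarrow> block_vec d u j = R *\<^sub>v w j" for m G u w
  proof -
    have "(cvec_norm (amplify d \<pi> G *\<^sub>v u))\<^sup>2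
        = (\<Sum>r<m. (cvec_norm (R *\<^sub>v vec d (\<lambda>i. \<Sum>l<m. (G $$ (r, l)) (pt i) * w l $ i)))\<^sup>2)"
      unfolding \<pi>_def by (rule cvec_norm_amplify_conj_diag[OF conj that])
    also have "\<dots> = (\<Sum>r<m. quad d q' (act pt m G (\<lambda>l i. w l $ i) r))"
      by (intro sum.cong refl) (auto simp: norm_R act_def[OF ctxt] intro!: quad_cong)
    finally show ?thesis .
  qed
  have "op_norm (amplify d \<pi> G) \<le> nrm G" if m: "0 < m" and G: "G \<in> matrices_over m A" for m G
  proof (rule op_norm_leI)
    show "0 \<le> nrm G" by (rule nrm_nonneg[OF m G])
    fix u :: "complex vec" assume "u \<in> carrier_vec (dim_col (amplify d \<pi> G))"
    moreover have "dim_col (amplify d \<pi> G) = m * d"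
      using G by (auto simp: amplify_def matrices_over_iff)
    ultimately have u: "u \<in> carrier_vec (m * d)" by metis
    define w where "w j = R' *\<^sub>v block_vec d u j" for j
    have blk: "block_vec d u j \<in> carrier_vec d" for j by (simp add: block_vec_def)
    have w: "w j \<in> carrier_vec d" for j unfolding w_def by (rule mult_mat_vec_carrier[OF R' blk])
    have Rw: "R *\<^sub>v w j = block_vec d u j" for j
      unfolding w_def using assoc_mult_mat_vec[OF R R' blk, of j] blk[of j] by (simp add: RR')
    have "(cvec_norm (amplify d \<pi> G *\<^sub>v u))\<^sup>2 = (\<Sum>r<m. quad d q' (act pt m G (\<lambda>l i. w l $ i) r))"
      using G u w Rw by (intro norm_\<pi>) (auto simp: matrices_over_iff)
    also have "\<dots> = (\<Sum>r<m. quad d q (act pt m G (\<lambda>l i. w l $ i) r))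
        + \<epsilon> * (\<Sum>r<m. \<Sum>i<d. (cmod (\<Sum>l<m. (G $$ (r, l)) (pt i) * w l $ i))\<^sup>2)"
      by (simp add: q' sum.distrib sum_distrib_left act_def[OF ctxt])
    also have "\<dots> \<le> (nrm G)\<^sup>2 * (\<Sum>l<m. quad d q (\<lambda>i. w l $ i))
        + \<epsilon> * ((nrm G)\<^sup>2 * (\<Sum>l<m. \<Sum>i<d. (cmod (w l $ i))\<^sup>2))"
      using \<epsilon> by (intro add_mono contr[OF m G] mult_left_mono eval_blocks_contractive[OF m G]) simp
    also have "\<dots> = (nrm G)\<^sup>2 * ((\<Sum>l<m. quad d q (\<lambda>i. w l $ i))
        + \<epsilon> * (\<Sum>l<m. \<Sum>i<d. (cmod (w l $ i))\<^sup>2))"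
      by (simp only: distrib_left mult.left_commute)
    also have "\<dots> = (nrm G)\<^sup>2 * (\<Sum>l<m. quad d q' (\<lambda>i. w l $ i))"
      by (simp add: q' sum.distrib sum_distrib_left)
    also have "\<dots> = (nrm G)\<^sup>2 * (\<Sum>l<m. (cvec_norm (block_vec d u l))\<^sup>2)"
      by (simp add: norm_R[OF w, symmetric] Rw)
    also have "\<dots> = (nrm G * cvec_norm u)\<^sup>2"
      using u by (subst cvec_norm_blocks[of u m d, symmetric]) (simp_all add: power_mult_distrib)
    finally show "cvec_norm (amplify d \<pi> G *\<^sub>v u) \<le> nrm G * cvec_norm u"
      by (rule power2_le_imp_le) (simp add: nrm_nonneg[OF m G] cvec_norm_nonneg)
  qed
  then have hom: "completely_contractive_hom fun_scale A nrm d \<pi>"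
    unfolding completely_contractive_hom_def \<pi>_def
    by (simp add: conj_diag_carrier[OF conj] conj_diag_add[OF conj] conj_diag_scale[OF conj]
        conj_diag_mult[OF conj])
  \<comment> \<open>The test vector: the tuple of generators \<open>e_vec\<close>, carried blockwise
    to Euclidean coordinates by \<open>R\<close>.\<close>
  define w where "w j = vec d (e_vec co j)" for j
  define u where "u = vec (n * d) (\<lambda>k. (R *\<^sub>v w (k div d)) $ (k mod d))"
  have u: "u \<in> carrier_vec (n * d)" and w: "w j \<in> carrier_vec d" for j
    by (simp_all add: u_def w_def)
  have blocks: "block_vec d u j = R *\<^sub>v w j" if "j < n" for j
    using R that block_index_less[of j n _ d]
    by (intro eq_vecI) (auto simp: block_vec_def u_def simp del: index_mult_mat_vec)
  have "(cvec_norm u)\<^sup>2 = (\<Sum>j<n. quad d q' (e_vec co j))"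
    unfolding cvec_norm_blocks[OF carrier_vecD[OF u]]
    by (intro sum.cong refl) (simp add: blocks norm_R[OF w], auto simp: w_def intro!: quad_cong)
  also have "\<dots> = s + \<epsilon> * (\<Sum>j<n. \<Sum>i<d. (cmod (e_vec co j i))\<^sup>2)"
    by (simp add: q' sum.distrib s_def sum_distrib_left)
  \<comment> \<open>Each index \<open>i\<close> lies in the support of exactly one
    generator.\<close>
  also have "(\<Sum>j<n. \<Sum>i<d. (cmod (e_vec co j i))\<^sup>2) = (\<Sum>i<d. \<Sum>j<n. if j = co i then 1 else 0)"
    by (subst sum.swap) (auto simp: e_vec_def[OF ctxt] intro!: sum.cong)
  also have "\<dots> = d"
  proof -
    have "co i < n" if "i < d" for i using bij that by (auto simp: bij_betw_def)
    then show ?thesis by simp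
  qed
  also have "\<epsilon> * d = s * (1 - c\<^sup>2)" using d by (simp add: \<epsilon>_def)
  also have "s + \<dots> = s * (2 - c\<^sup>2)" by (simp add: algebra_simps)
  finally have norm_u: "(cvec_norm u)\<^sup>2 = s * (2 - c\<^sup>2)" .
  have "s \<le> (\<Sum>r<n. quad d q (row0 pt co G0 r))" using excess by (simp add: s_def)
  also have "\<dots> \<le> (\<Sum>r<n. quad d q' (row0 pt co G0 r))"
    using \<epsilon> by (intro sum_mono) (simp add: q' sum_nonneg)
  also have "\<dots> = (\<Sum>r<n. quad d q' (act pt n G0 (\<lambda>l i. w l $ i) r))"
  proof (intro sum.cong refl quad_cong)
    fix r i assume "i < d"
    have "co i < n" using bij \<open>i < d\<close> by (auto simp: bij_betw_def)
    have "act pt n G0 (\<lambda>l i. w l $ i) r i = (\<Sum>l<n. if l = co i then (G0 $$ (r, co i)) (pt i) else 0)"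
      unfolding act_def[OF ctxt] using \<open>i < d\<close> by (intro sum.cong) (auto simp: w_def e_vec_def[OF ctxt])
    with \<open>co i < n\<close> show "row0 pt co G0 r i = act pt n G0 (\<lambda>l i. w l $ i) r i"
      by (simp add: row0_def[OF ctxt])
  qed
  also have "\<dots> = (cvec_norm (amplify d \<pi> G0 *\<^sub>v u))\<^sup>2"
    using G0 by (intro norm_\<pi>[symmetric] u w blocks) (simp add: matrices_over_iff)
  also have "\<dots> \<le> (op_norm (amplify d \<pi> G0) * cvec_norm u)\<^sup>2"
  proof (intro power_mono cvec_norm_mult_le cvec_norm_nonneg)
    have "dim_col (amplify d \<pi> G0) = n * d"
      using G0 by (auto simp: amplify_def matrices_over_iff)
    with u show "u \<in> carrier_vec (dim_col (amplify d \<pi> G0))" by metis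
  qed
  also have "\<dots> = (op_norm (amplify d \<pi> G0))\<^sup>2 * (2 - c\<^sup>2) * s"
    by (simp add: power_mult_distrib norm_u)
  finally have "1 * s \<le> (op_norm (amplify d \<pi> G0))\<^sup>2 * (2 - c\<^sup>2) * s" by simp
  then have one_le: "1 \<le> (op_norm (amplify d \<pi> G0))\<^sup>2 * (2 - c\<^sup>2)"
    using pos by (simp only: s_def[symmetric] mult_le_cancel_right_pos)
  \<comment> \<open>Expanding this square gives \<open>c^2 * (2 - c^2) <= 1\<close>, which converts
    the estimate with the factor \<open>2 - c^2\<close> into the bound \<open>c\<close>.\<close>
  have "0 \<le> (1 - c\<^sup>2)\<^sup>2" by simp
  then have "c\<^sup>2 * (2 - c\<^sup>2) \<le> 1" by (simp add: power2_diff algebra_simps power2_eq_square)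
  with one_le have "c\<^sup>2 * (2 - c\<^sup>2) \<le> (op_norm (amplify d \<pi> G0))\<^sup>2 * (2 - c\<^sup>2)" by simp
  then have "c\<^sup>2 \<le> (op_norm (amplify d \<pi> G0))\<^sup>2"
    using c2 by (simp add: mult_le_cancel_right)
  then have "c \<le> op_norm (amplify d \<pi> G0)"
    by (rule power2_le_imp_le) (rule op_norm_nonneg)
  with d hom show ?thesis by blast
qed

lemma quotient_norm_scale_ge:
  assumes n: "0 < n" and G: "G \<in> matrices_over n A" and a: "0 < a"
  shows "a * quotient_norm A nrm F G \<le> quotient_norm A nrm F (map_mat (fun_scale (of_real a)) G)"
proof (rule le_quotient_normI)
  show "map_mat (fun_scale (of_real a)) G \<in> matrices_over n A"
    using G by (auto simp: matrices_over_iff intro!: scale_in)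
  fix K assume K: "K \<in> matrices_over n A" and agree: "agree_on F n K (map_mat (fun_scale (of_real a)) G)"
  define H where "H = map_mat (fun_scale (of_real (1 / a))) K"
  have H: "H \<in> matrices_over n A" using K by (auto simp: H_def matrices_over_iff intro!: scale_in)
  have "agree_on F n H G"
    using agree K G a by (auto simp: agree_on_def H_def matrices_over_iff fun_scale_def)
  then have "quotient_norm A nrm F G \<le> nrm H" by (rule quotient_norm_le[OF n G H])
  also have "nrm H = (1 / a) * nrm K" unfolding H_def nrm_scale[OF n K] using a by (simp add: norm_divide)
  finally show "a * quotient_norm A nrm F G \<le> nrm K" using a by (simp add: field_simps)
qed

lemma zero_completely_contractive:
  "completely_contractive_hom fun_scale A nrm 1 (\<lambda>_. 0\<^sub>m 1 1)"
proof -
  have "op_norm (amplify 1 (\<lambda>_. 0\<^sub>m 1 1) G) \<le> nrm G" if "0 < m" "G \<in> matrices_over m A" for m G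
  proof (rule op_norm_leI)
    show "0 \<le> nrm G" by (rule nrm_nonneg[OF that])
    fix v :: "complex vec" assume v: "v \<in> carrier_vec (dim_col (amplify 1 (\<lambda>_. 0\<^sub>m 1 1) G))"
    have "amplify 1 (\<lambda>_. 0\<^sub>m 1 1) G = 0\<^sub>m (dim_row G) (dim_col G)"
      by (auto simp: amplify_def)
    with v have "amplify 1 (\<lambda>_. 0\<^sub>m 1 1) G *\<^sub>v v = 0\<^sub>v (dim_row G)" by (auto simp: amplify_def)
    then show "cvec_norm (amplify 1 (\<lambda>_. 0\<^sub>m 1 1) G *\<^sub>v v) \<le> nrm G * cvec_norm v"
      using nrm_nonneg[OF that] by (simp add: cvec_norm_nonneg)
  qed
  then show ?thesis unfolding completely_contractive_hom_def by auto
qed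

end

theorem corollary3p5:
  fixes A :: "('x \<Rightarrow> complex) set"
    and nrm :: "('x \<Rightarrow> complex) mat \<Rightarrow> real"
  assumes "function_operator_algebra A nrm"
    and "local_algebra A nrm"
  shows "RFD fun_scale A nrm"
  unfolding RFD_def
proof (intro allI impI ballI)
  interpret function_operator_algebra A nrm by fact
  fix n :: nat and G assume n: "0 < n" and G: "G \<in> matrices_over n A"
  define S where "S = {op_norm (amplify k \<pi> G) | k \<pi>.
    0 < k \<and> completely_contractive_hom fun_scale A nrm k \<pi>}"
  have S_le: "x \<le> nrm G" if "x \<in> S" for x
    using that n G by (auto simp: S_def completely_contractive_hom_def)
  have zero: "op_norm (amplify 1 (\<lambda>_. 0\<^sub>m 1 1) G) \<in> S"
    unfolding S_def using zero_completely_contractive by fastforce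
  have bdd: "bdd_above S" using S_le by (auto simp: bdd_above_def)
  have Sup_nonneg: "0 \<le> Sup S"
    using cSup_upper[OF zero bdd] op_norm_nonneg order_trans by blast
  have quotient_le: "quotient_norm A nrm F G \<le> Sup S" if F: "finite F" for F
  proof (cases "0 < quotient_norm A nrm F G")
    case False
    with Sup_nonneg show ?thesis by simp
  next
    case True
    let ?\<nu> = "quotient_norm A nrm F G"
    \<comment> \<open>One factor \<open>c\<close> is the loss in the near-norming homomorphism; the
      other comes from scaling \<open>G\<close> so that its quotient norm is at least
      \<open>1 / c\<close>, strictly above 1.\<close>
    have c2: "c * c * ?\<nu> \<le> Sup S" if c: "0 < c" "c < 1" for c
    proof -
      define a where "a = 1 / (c * ?\<nu>)"
      have a: "0 < a" using c True by (simp add: a_def)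
      let ?G = "map_mat (fun_scale (of_real a)) G"
      have G': "?G \<in> matrices_over n A" using G by (auto simp: matrices_over_iff intro!: scale_in)
      have "1 < 1 / c" using c by simp
      also have "1 / c = a * ?\<nu>" using c True by (simp add: a_def)
      also have "\<dots> \<le> quotient_norm A nrm F ?G" by (rule quotient_norm_scale_ge[OF n G a])
      finally obtain k \<pi> where k: "0 < k" and \<pi>: "completely_contractive_hom fun_scale A nrm k \<pi>"
        and le: "c \<le> op_norm (amplify k \<pi> ?G)"
        using exists_near_norming_hom[OF n F G' _ c] by blast
      have "amplify k \<pi> ?G = of_real a \<cdot>\<^sub>m amplify k \<pi> G"
      proof (rule eq_matI)
        fix i j assume "i < dim_row (of_real a \<cdot>\<^sub>m amplify k \<pi> G)" "j < dim_col (of_real a \<cdot>\<^sub>m amplify k \<pi> G)"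
        then have ij: "i < n * k" "j < n * k" using G by (auto simp: amplify_def matrices_over_iff)
        then have "i div k < n" "j div k < n" "i mod k < k" "j mod k < k"
          using k by (auto simp: less_mult_imp_div_less)
        moreover from this have "\<pi> (G $$ (i div k, j div k)) \<in> carrier_mat k k"
          "\<pi> (fun_scale (of_real a) (G $$ (i div k, j div k))) = of_real a \<cdot>\<^sub>m \<pi> (G $$ (i div k, j div k))"
          using \<pi> G by (auto simp: completely_contractive_hom_def matrices_over_iff)
        ultimately show "amplify k \<pi> ?G $$ (i, j) = (of_real a \<cdot>\<^sub>m amplify k \<pi> G) $$ (i, j)"
          using ij G by (auto simp: amplify_def matrices_over_iff)
      qed (auto simp: amplify_def)
      with le op_norm_smult_le[of "of_real a" "amplify k \<pi> G"] a
      have "c \<le> a * op_norm (amplify k \<pi> G)" by simp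
      moreover have "op_norm (amplify k \<pi> G) \<le> Sup S"
        using k \<pi> by (intro cSup_upper[OF _ bdd]) (auto simp: S_def)
      ultimately have "c \<le> a * Sup S" 
        using mult_left_mono[of "op_norm (amplify k \<pi> G)" "Sup S" a] a by linarith
      with c True show ?thesis by (simp add: a_def field_simps)
    qed
    show ?thesis
    \<comment> \<open>Taking \<open>c = sqrt z\<close> and letting \<open>z\<close> tend to 1
      removes both losses.\<close>
    proof (rule field_le_mult_one_interval)
      fix z :: real assume z: "0 < z" "z < 1"
      then have "sqrt z * sqrt z * ?\<nu> \<le> Sup S" by (intro c2) auto
      with z show "z * ?\<nu> \<le> Sup S" by simp
    qed
  qed
  have "nrm G = (SUP F \<in> {F. finite F}. quotient_norm A nrm F G)"
    using assms(2) n G by (auto simp: local_algebra_def)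
  also have "\<dots> \<le> Sup S" using quotient_le by (intro cSUP_least) auto
  finally have "nrm G \<le> Sup S" .
  moreover have "Sup S \<le> nrm G" using zero S_le by (intro cSup_least) auto
  ultimately show "nrm G = Sup {op_norm (amplify k \<pi> G) | k \<pi>.
      0 < k \<and> completely_contractive_hom fun_scale A nrm k \<pi>}"
    by (simp add: S_def)
qed

end
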